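(* Let $m,n,r,s,\lambda$ be positive integers with $n>m>3$. An $r$-factorization of $\lambda K_m^3$ can be embedded into a connected $s$-factorization of $\lambda K_n^3$ if and only if (i) $(m,r,\lambda)$ and $(n,s,\lambda)$ are $3$-admissible; (ii) $1<s/r\le\binom{n-1}{2}/\binom{m-1}{2}$; (iii) if $r\binom{n-1}{2}>s\binom{m-1}{2}$, then $n\ge 3m/2$; (iv) $(n-m)\binom m2\ge\big(m-\frac n3\big)\Big[\binom{n-1}{2}-\frac sr\binom{m-1}{2}\Big]$.
   Context: $\lambda K_n^h$: $n$ vertices, every $h$-subset an edge of multiplicity $\lambda$; $\lambda K_m^h$ is its sub-hypergraph induced on a fixed set of $m$ vertices. An $r$-factor is a spanning sub-hypergraph in which every vertex has degree $r$; an $r$-factorization is a partition of the edges into $r$-factors. An $r$-factorization of $\lambda K_m^h$ embeds into a connected $s$-factorization of $\lambda K_n^h$ if there is a partition of the edges of $\lambda K_n^h$ into connected $s$-factors such that each given $r$-factor is contained in one of them and distinct $r$-factors are contained in distinct $s$-factors. $(n,r,\lambda)$ is $h$-admissible if $h\mid rn$ and $r\mid\lambda\binom{n-1}{h-1}$. *)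

theory Defs
  imports Complex_Main "HOL-Library.Disjoint_Sets"
begin

text \<open>A hypergraph with repeated edges on a vertex set \<open>V\<close> is given by its set of edges,
  an edge being a pair of its underlying set of vertices and a label; parallel copies of an
  edge are distinguished by their labels, so that a partition of the edges is literally a
  partition of a set.\<close>

type_synonym 'a medge = "'a set \<times> nat"

definition complete_edges :: "nat \<Rightarrow> nat \<Rightarrow> 'a set \<Rightarrow> 'a medge set" where
  "complete_edges lam h V = {e. e \<subseteq> V \<and> card e = h} \<times> {..<lam}"

text \<open>For \<open>U \<subseteq> V\<close>, the sub-hypergraph of the complete one on \<open>V\<close> induced on \<open>U\<close> is the
  complete one on \<open>U\<close>, with the same labels.\<close>

lemma complete_edges_induced:
  "U \<subseteq> V \<Longrightarrow> complete_edges lam h U = {x \<in> complete_edges lam h V. fst x \<subseteq> U}"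
  by (auto simp: complete_edges_def)

definition degree :: "'a medge set \<Rightarrow> 'a \<Rightarrow> nat" where
  "degree E v = card {x \<in> E. v \<in> fst x}"

definition is_factor :: "nat \<Rightarrow> 'a set \<Rightarrow> 'a medge set \<Rightarrow> 'a medge set \<Rightarrow> bool" where
  "is_factor r V E H \<longleftrightarrow> H \<subseteq> E \<and> (\<forall>v\<in>V. degree H v = r)"

definition is_factorization ::
    "nat \<Rightarrow> 'a set \<Rightarrow> 'a medge set \<Rightarrow> 'a medge set set \<Rightarrow> bool" where
  "is_factorization r V E F \<longleftrightarrow> partition_on E F \<and> (\<forall>H\<in>F. is_factor r V E H)"

definition hconnected :: "'a set \<Rightarrow> 'a medge set \<Rightarrow> bool" where
  "hconnected V H \<longleftrightarrow>
     (\<forall>u\<in>V. \<forall>v\<in>V. (u, v) \<in> {(x, y). \<exists>e\<in>H. x \<in> fst e \<and> y \<in> fst e}\<^sup>*)"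

text \<open>The factors of \<open>F\<close> live on a smaller vertex set; \<open>V\<close> and \<open>E\<close> are the vertices and
  edges of the large hypergraph. The map \<open>f\<close> sends each factor in \<open>F\<close> to the factor
  containing it.\<close>

definition embeds_connected ::
    "'a medge set set \<Rightarrow> nat \<Rightarrow> 'a set \<Rightarrow> 'a medge set \<Rightarrow> bool" where
  "embeds_connected F s V E \<longleftrightarrow>
     (\<exists>G. is_factorization s V E G \<and> (\<forall>H\<in>G. hconnected V H) \<and>
          (\<exists>f. f ` F \<subseteq> G \<and> inj_on f F \<and> (\<forall>P\<in>F. P \<subseteq> f P)))"

definition admissible :: "nat \<Rightarrow> nat \<Rightarrow> nat \<Rightarrow> nat \<Rightarrow> bool" where
  "admissible h n r lam \<longleftrightarrow> h dvd r * n \<and> r dvd lam * ((n - 1) choose (h - 1))"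

end

theory Submission
  imports Defs "HOL-Combinatorics.Transposition"
begin

text \<open>Everything rests on one operation. Given two vertices \<open>v\<close>, \<open>w\<close>, the transposition of \<open>v\<close> and
  \<open>w\<close> is a perfect matching on the edges containing exactly one of them; pairing up such edges of
  equal colour gives a second matching. The union of two matchings is bipartite, so the edges can
  be reassigned to \<open>v\<close> and \<open>w\<close> such that each set \<open>X \<union> {v}\<close>, \<open>X \<union> {w}\<close> is still used once,
  while in every colour the edges at \<open>v\<close> and at \<open>w\<close> become equally many up to one. No other degree
  changes.

  Applied to pairs inside \<open>U\<close> and inside \<open>V - U\<close>, to the edges not contained in \<open>U\<close> only, this
  turns any extension of the given colouring with correct degree sums over \<open>U\<close> and \<open>V - U\<close> into an
  \<open>s\<close>-factorization; the conditions (ii)--(iv) say that correct degree sums are possible. As the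
  pairing inside a colour is free, one pair of edges per colour can be forced to end up at
  different vertices, which connects a disconnected factor without disconnecting another one.\<close>

section \<open>Re-splitting two vertices\<close>

text \<open>Let q and k be the numbers of factors on \<open>U\<close> and on \<open>V\<close>, so
  \<open>q * r = lam * ((m - 1) choose 2)\<close> and
  \<open>k * s = lam * ((n - 1) choose 2)\<close>. Condition (ii) says r < s and q \<le> k. A new
  factor has no edge inside \<open>U\<close>, so each of its s n / 3 edges adds at most 2 to its
  degree sum s m over \<open>U\<close>: this is (iii). At least s m - s n / 3 of these edges must
  add exactly 2, and only lam (n - m) (m choose 2) edges meet \<open>U\<close> in two vertices:
  summed over the k - q new factors, this is (iv). Conversely, as edges have size 3, the two degree
  sums of a colour leave one integer free, which ranges over an interval. Rounding at the upper end
  of that interval is not covered by the conditions and needs an estimate of its own.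

  A re-split acts on all colours at once, so repairing one factor could cut another; this is the
  obstacle to connectedness. The strict inequality r < s gives every vertex of \<open>U\<close> an
  edge leaving \<open>U\<close> in each colour, so every component meets V - U and can be treated
  there, away from the given factors.\<close>

text \<open>Alternating between the two matchings traces paths and even cycles. The induction
  contracts one pair of \<open>\<mu>\<close>, which shortens its path or cycle by two vertices and
  keeps the other matching perfect.\<close>

lemma two_matchings_bipartite:
  assumes "finite Z"
    and "\<And>x. x \<in> Z \<Longrightarrow> \<tau> x \<in> Z \<and> \<tau> (\<tau> x) = x \<and> \<tau> x \<noteq> x"
    and "\<And>x. x \<in> Z \<Longrightarrow> \<mu> x \<in> Z \<and> \<mu> (\<mu> x) = x"
  shows "\<exists>b. \<forall>x\<in>Z. b (\<tau> x) = (\<not> b x) \<and> (\<mu> x \<noteq> x \<longrightarrow> b (\<mu> x) = (\<not> b x))"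
  using assms
proof (induction "card Z" arbitrary: Z \<tau> rule: less_induct)
  case less
  note fin = less.prems(1) and t = less.prems(2) and m = less.prems(3)
  show ?case
  proof (cases "\<exists>x\<in>Z. \<mu> x \<noteq> x")
    case False
    \<comment> \<open>Without pairs of \<open>\<mu>\<close> it suffices to mark one point in each
      orbit of \<open>\<tau>\<close>. The choice depends on the set {x, \<tau> x} only, so both
      points of an orbit agree on it.\<close>
    define b where "b x \<longleftrightarrow> x = (SOME y. y \<in> {x, \<tau> x})" for x
    have "b (\<tau> x) = (\<not> b x)" if "x \<in> Z" for x
    proof -
      have "{\<tau> x, \<tau> (\<tau> x)} = {x, \<tau> x}" using t[OF that] by auto
      moreover have "(SOME y. y \<in> {x, \<tau> x}) \<in> {x, \<tau> x}" by (rule someI[of _ x]) simp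
      ultimately show ?thesis using t[OF that] unfolding b_def by auto
    qed
    then show ?thesis using False by blast
  next
    case True
    then obtain x where x: "x \<in> Z" "\<mu> x \<noteq> x" by blast
    define y where "y = \<mu> x"
    have y: "y \<in> Z" "y \<noteq> x" "\<mu> y = x" using m[OF x(1)] x by (auto simp: y_def)
    define Z' where "Z' = Z - {x, y}"
    \<comment> \<open>The partners of the deleted \<open>x\<close> and \<open>y\<close> are matched
      with each other. If \<open>\<tau>\<close> pairs \<open>x\<close> with \<open>y\<close>, no
      remaining point is affected.\<close>
    define \<tau>' where "\<tau>' z = (if \<tau> z = x then \<tau> y else if \<tau> z = y then \<tau> x else \<tau> z)" for z
    have less_card: "card Z' < card Z"
      unfolding Z'_def using fin x(1) by (intro psubset_card_mono) auto
    have m': "\<mu> z \<in> Z' \<and> \<mu> (\<mu> z) = z" if "z \<in> Z'" for z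
    proof -
      have z: "z \<in> Z" "z \<noteq> x" "z \<noteq> y" using that by (auto simp: Z'_def)
      have "\<mu> z \<noteq> x" using m[OF z(1)] z(3) by (auto simp: y_def)
      moreover have "\<mu> z \<noteq> y" using m[OF z(1)] z(2) y(3) by auto
      ultimately show ?thesis using m[OF z(1)] by (simp add: Z'_def)
    qed
    have t': "\<tau>' z \<in> Z' \<and> \<tau>' (\<tau>' z) = z \<and> \<tau>' z \<noteq> z" if "z \<in> Z'" for z
    proof -
      have z: "z \<in> Z" "z \<noteq> x" "z \<noteq> y" using that by (auto simp: Z'_def)
      consider "\<tau> z = x" | "\<tau> z = y" | "\<tau> z \<noteq> x" "\<tau> z \<noteq> y" by blast
      then show ?thesis
      proof cases
        case 1
        then have "\<tau> x = z" using t[OF z(1)] by simp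
        moreover from this have "\<tau> y \<noteq> z" using t[OF y(1)] t[OF x(1)] y(2) by metis
        ultimately show ?thesis
          using 1 t[OF y(1)] y(2) z by (auto simp: \<tau>'_def Z'_def)
      next
        case 2
        then have "\<tau> y = z" using t[OF z(1)] by simp
        moreover from this have "\<tau> x \<noteq> z" using t[OF y(1)] t[OF x(1)] y(2) by metis
        ultimately show ?thesis
          using 2 t[OF x(1)] y(2) z by (auto simp: \<tau>'_def Z'_def)
      next
        case 3
        then show ?thesis using t[OF z(1)] z by (auto simp: \<tau>'_def Z'_def)
      qed
    qed
    have "finite Z'" using fin by (simp add: Z'_def)
    from less.hyps[OF less_card this t' m'] obtain b where
      b: "\<And>z. z \<in> Z' \<Longrightarrow> b (\<tau>' z) = (\<not> b z) \<and> (\<mu> z \<noteq> z \<longrightarrow> b (\<mu> z) = (\<not> b z))" by blast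
    \<comment> \<open>If \<open>\<tau>\<close> pairs \<open>x\<close> with \<open>y\<close>, they
      form a cycle of their own and may be marked either way. Otherwise each is marked opposite to
      its partner; the partners are matched by \<open>\<tau>'\<close> and hence differ, so
      \<open>x\<close> and \<open>y\<close> differ as \<open>\<mu>\<close> requires.\<close>
    define b' where "b' z = (if \<tau> x = y then (if z = x then True else if z = y then False else b z)
        else if z = x then \<not> b (\<tau> x) else if z = y then \<not> b (\<tau> y) else b z)" for z
    have "b' (\<tau> z) = (\<not> b' z) \<and> (\<mu> z \<noteq> z \<longrightarrow> b' (\<mu> z) = (\<not> b' z))" if z: "z \<in> Z" for z
    proof (cases "\<tau> x = y")
      case True
      have "\<tau> y = x" using True t[OF x(1)] by simp
      show ?thesis
      proof (cases "z = x \<or> z = y")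
        case zxy: True
        then show ?thesis using True \<open>\<tau> y = x\<close> y(2,3) by (auto simp: b'_def y_def[symmetric])
      next
        case zn: False
        then have "z \<in> Z'" using z by (simp add: Z'_def)
        note bz = b[OF this] and mz = m'[OF this]
        have "\<tau> z \<noteq> x" "\<tau> z \<noteq> y" using t[OF z] zn True \<open>\<tau> y = x\<close> by auto
        then have "b' (\<tau> z) = (\<not> b z)" using bz True unfolding b'_def \<tau>'_def by simp
        moreover have "b' (\<mu> z) = b (\<mu> z)" "b' z = b z"
          using mz zn True unfolding b'_def Z'_def by auto
        ultimately show ?thesis using bz by simp
      qed
    next
      case False
      have tx: "\<tau> x \<in> Z'" "\<tau> y \<in> Z'" "\<tau> x \<noteq> x" "\<tau> y \<noteq> y" "\<tau> x \<noteq> \<tau> y"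
        using False t[OF x(1)] t[OF y(1)] y(2) unfolding Z'_def by auto
      have opp: "b (\<tau> y) = (\<not> b (\<tau> x))"
        using b[OF tx(1)] t[OF x(1)] unfolding \<tau>'_def by simp
      show ?thesis
      proof (cases "z = x \<or> z = y")
        case True
        then show ?thesis
          using opp tx y(2,3) False t[OF x(1)] t[OF y(1)] unfolding b'_def y_def[symmetric]
          by (auto simp: Z'_def y_def[symmetric])
      next
        case zn: False
        then have "z \<in> Z'" using z by (simp add: Z'_def)
        note bz = b[OF this] and mz = m'[OF this]
        have "b' (\<mu> z) = b (\<mu> z)" "b' z = b z"
          using mz zn False unfolding b'_def Z'_def by auto
        moreover have "b' (\<tau> z) = (\<not> b z)"
          using bz zn False t[OF z] opp unfolding b'_def \<tau>'_def by auto
        ultimately show ?thesis using bz by simp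
      qed
    qed
    then show ?thesis by blast
  qed
qed

lemma almost_perfect_pairing:
  assumes "finite A"
  shows "\<exists>\<mu>. (\<forall>x\<in>A. \<mu> x \<in> A \<and> \<mu> (\<mu> x) = x) \<and> (\<forall>x\<in>A. \<forall>y\<in>A. \<mu> x = x \<longrightarrow> \<mu> y = y \<longrightarrow> x = y)"
  using assms
proof (induction A)
  case empty
  then show ?case by simp
next
  case (insert a A)
  then obtain \<mu> where
    mu: "\<forall>x\<in>A. \<mu> x \<in> A \<and> \<mu> (\<mu> x) = x" "\<forall>x\<in>A. \<forall>y\<in>A. \<mu> x = x \<longrightarrow> \<mu> y = y \<longrightarrow> x = y"
    by blast
  show ?case
  proof (cases "\<exists>z\<in>A. \<mu> z = z")
    case True
    then obtain z where z: "z \<in> A" "\<mu> z = z" by blast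
    have nz: "\<mu> x \<noteq> z" if "x \<in> A" "x \<noteq> z" for x using mu(1) that z(2) by metis
    have na: "\<mu> x \<noteq> a" if "x \<in> A" for x using mu(1) that insert.hyps by metis
    have "a \<noteq> z" using z insert.hyps by blast
    show ?thesis
    proof (intro exI[of _ "\<mu>(a := z, z := a)"] conjI ballI impI)
      fix x assume "x \<in> insert a A"
      then show "(\<mu>(a := z, z := a)) x \<in> insert a A"
        "(\<mu>(a := z, z := a)) ((\<mu>(a := z, z := a)) x) = x"
        using nz[of x] na[of x] mu(1) z \<open>a \<noteq> z\<close> by auto
    next
      have fixed: "x \<in> A \<and> x \<noteq> z \<and> \<mu> x = x"
        if "x \<in> insert a A" "(\<mu>(a := z, z := a)) x = x" for x
        using that \<open>a \<noteq> z\<close> by (auto split: if_splits)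
      fix x y assume "x \<in> insert a A" "y \<in> insert a A"
        "(\<mu>(a := z, z := a)) x = x" "(\<mu>(a := z, z := a)) y = y"
      then show "x = y" using fixed mu(2) by blast
    qed
  next
    case False
    show ?thesis
    proof (intro exI[of _ "\<mu>(a := a)"] conjI ballI impI)
      have na: "\<mu> x \<noteq> a" if "x \<in> A" for x using mu(1) that insert.hyps by metis
      fix x assume "x \<in> insert a A"
      then show "(\<mu>(a := a)) x \<in> insert a A" "(\<mu>(a := a)) ((\<mu>(a := a)) x) = x"
        using na[of x] mu(1) insert.hyps by auto
    next
      have "x = a" if "x \<in> insert a A" "(\<mu>(a := a)) x = x" for x
        using that False by (metis fun_upd_other insertE)
      then show "x = y" if "x \<in> insert a A" "y \<in> insert a A"
        "(\<mu>(a := a)) x = x" "(\<mu>(a := a)) y = y" for x y using that by blast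
    qed
  qed
qed

lemma almost_perfect_pairing_with_pair:
  assumes "finite A" and "p \<in> A" "p' \<in> A" "p \<noteq> p'"
  shows "\<exists>\<mu>. (\<forall>x\<in>A. \<mu> x \<in> A \<and> \<mu> (\<mu> x) = x) \<and>
    (\<forall>x\<in>A. \<forall>y\<in>A. \<mu> x = x \<longrightarrow> \<mu> y = y \<longrightarrow> x = y) \<and> \<mu> p = p'"
proof -
  have "finite (A - {p, p'})" using assms by simp
  from almost_perfect_pairing[OF this] obtain \<mu> where
    mu: "\<forall>x\<in>A - {p, p'}. \<mu> x \<in> A - {p, p'} \<and> \<mu> (\<mu> x) = x"
      "\<forall>x\<in>A - {p, p'}. \<forall>y\<in>A - {p, p'}. \<mu> x = x \<longrightarrow> \<mu> y = y \<longrightarrow> x = y" by blast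
  let ?\<nu> = "\<mu>(p := p', p' := p)"
  have fixed: "x \<in> A - {p, p'} \<and> \<mu> x = x" if "x \<in> A" "?\<nu> x = x" for x
    using that assms(4) by (auto split: if_splits)
  show ?thesis
  proof (intro exI[of _ ?\<nu>] conjI ballI impI)
    fix x assume "x \<in> A"
    then show "?\<nu> x \<in> A" "?\<nu> (?\<nu> x) = x" using mu(1) assms by auto
  next
    fix x y assume "x \<in> A" "y \<in> A" "?\<nu> x = x" "?\<nu> y = y"
    then show "x = y" using fixed mu(2) by blast
  next
    show "?\<nu> p = p'" using assms(4) by simp
  qed
qed

text \<open>Paired points cancel, so the bound 1 is the contribution of the only possible fixed
  point.\<close>

lemma balanced_by_pairing:
  assumes "finite A" and mu: "\<And>x. x \<in> A \<Longrightarrow> \<mu> x \<in> A \<and> \<mu> (\<mu> x) = x"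
    and one: "\<And>x y. x \<in> A \<Longrightarrow> y \<in> A \<Longrightarrow> \<mu> x = x \<Longrightarrow> \<mu> y = y \<Longrightarrow> x = y"
    and b: "\<And>x. x \<in> A \<Longrightarrow> \<mu> x \<noteq> x \<Longrightarrow> b (\<mu> x) = (\<not> b x)"
  shows "\<bar>int (card {x \<in> A. b x}) - int (card {x \<in> A. \<not> b x})\<bar> \<le> 1"
proof -
  have moved: "\<mu> (\<mu> x) \<noteq> \<mu> x" if "x \<in> A" "\<mu> x \<noteq> x" for x
    using mu[OF that(1)] that(2) by auto
  have "bij_betw \<mu> {x \<in> A. \<mu> x \<noteq> x \<and> b x} {x \<in> A. \<mu> x \<noteq> x \<and> \<not> b x}"
    by (rule bij_betwI[of _ _ _ \<mu>]) (use mu b moved in \<open>force simp: Pi_iff\<close>)+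
  then have eq: "card {x \<in> A. \<mu> x \<noteq> x \<and> b x} = card {x \<in> A. \<mu> x \<noteq> x \<and> \<not> b x}"
    by (rule bij_betw_same_card)
  have fix1: "card {x \<in> A. \<mu> x = x} \<le> 1"
    using one card_le_Suc0_iff_eq[of "{x \<in> A. \<mu> x = x}"] assms(1) by simp
  have s: "card {x \<in> A. b' x} = card {x \<in> A. \<mu> x \<noteq> x \<and> b' x} + card {x \<in> A. \<mu> x = x \<and> b' x}" for b'
  proof -
    have "{x \<in> A. b' x} = {x \<in> A. \<mu> x \<noteq> x \<and> b' x} \<union> {x \<in> A. \<mu> x = x \<and> b' x}" by auto
    then show ?thesis by (simp add: card_Un_disjoint assms(1) disjoint_iff)
  qed
  have le: "card {x \<in> A. \<mu> x = x \<and> b' x} \<le> 1" for b'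
    by (rule order_trans[OF _ fix1], rule card_mono) (use assms(1) in auto)
  show ?thesis using s[of b] s[of "\<lambda>x. \<not> b x"] le[of b] le[of "\<lambda>x. \<not> b x"] eq by linarith
qed

section \<open>The re-split and its effect on degrees\<close>

definition swap_edge :: "'a \<Rightarrow> 'a \<Rightarrow> 'a medge \<Rightarrow> 'a medge" where
  "swap_edge v w x = (transpose v w ` fst x, snd x)"

lemma mem_transpose_image: "z \<in> transpose v w ` A \<longleftrightarrow> transpose v w z \<in> A"
  by (metis image_iff transpose_involutory)

lemma swap_edge_twice [simp]: "swap_edge v w (swap_edge v w x) = x"
  by (simp add: swap_edge_def image_image)

lemma mem_swap_edge: "z \<in> fst (swap_edge v w x) \<longleftrightarrow> transpose v w z \<in> fst x"
  by (simp add: swap_edge_def mem_transpose_image)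

text \<open>The re-split is an involution \<open>\<phi>\<close> of the edges and the new colouring
  is \<open>col\<close> composed with it: for each pair \<open>x\<close>,
  \<open>swap_edge v w x\<close>, the two colours are either kept or exchanged. This way no edge is
  created or lost. \<open>K\<close> is the set of colours in which the pair \<open>p c\<close>,
  \<open>p' c\<close> has to be separated.\<close>

lemma resplit:
  fixes E :: "'a medge set" and col :: "'a medge \<Rightarrow> nat" and v w :: 'a
  defines "Z \<equiv> {x \<in> E. (v \<in> fst x) \<noteq> (w \<in> fst x)}"
  assumes fin: "finite E" and closed: "\<And>x. x \<in> E \<Longrightarrow> swap_edge v w x \<in> E"
    and p: "\<And>c. c \<in> K \<Longrightarrow> p c \<in> Z \<and> p' c \<in> Z \<and> p c \<noteq> p' c \<and> col (p c) = c \<and> col (p' c) = c"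
  obtains \<phi> where "\<And>x. x \<in> E \<Longrightarrow> \<phi> x \<in> E" "\<And>x. x \<in> E \<Longrightarrow> \<phi> (\<phi> x) = x"
    "\<And>x. \<phi> x = x \<or> \<phi> x = swap_edge v w x"
    "\<And>x. (v \<in> fst x) = (w \<in> fst x) \<Longrightarrow> \<phi> x = x"
    "\<And>c. c \<in> K \<Longrightarrow> (v \<in> fst (\<phi> (p c))) \<noteq> (v \<in> fst (\<phi> (p' c)))"
    "\<And>c. \<bar>int (card {x \<in> Z. col x = c \<and> v \<in> fst (\<phi> x)}) -
        int (card {x \<in> Z. col x = c \<and> w \<in> fst (\<phi> x)})\<bar> \<le> 1"
proof -
  let ?\<tau> = "swap_edge v w"
  have finZ: "finite Z" using fin by (simp add: Z_def)
  have mem: "v \<in> fst (?\<tau> x) \<longleftrightarrow> w \<in> fst x" "w \<in> fst (?\<tau> x) \<longleftrightarrow> v \<in> fst x" for x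
    by (auto simp: mem_swap_edge)
  have tau: "?\<tau> x \<in> Z \<and> ?\<tau> (?\<tau> x) = x \<and> ?\<tau> x \<noteq> x" if "x \<in> Z" for x
    using that closed mem[of x] unfolding Z_def by (auto dest: arg_cong[of _ _ fst])
  define A where "A c = {x \<in> Z. col x = c}" for c
  have "\<exists>\<mu>. (\<forall>x\<in>A c. \<mu> x \<in> A c \<and> \<mu> (\<mu> x) = x) \<and>
      (\<forall>x\<in>A c. \<forall>y\<in>A c. \<mu> x = x \<longrightarrow> \<mu> y = y \<longrightarrow> x = y) \<and> (c \<in> K \<longrightarrow> \<mu> (p c) = p' c)" for c
  proof (cases "c \<in> K")
    case True
    with p[OF True] have "p c \<in> A c" "p' c \<in> A c" "p c \<noteq> p' c" by (auto simp: A_def)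
    from almost_perfect_pairing_with_pair[OF _ this] show ?thesis
      using finZ True by (auto simp: A_def)
  next
    case False
    then show ?thesis using almost_perfect_pairing[of "A c"] finZ by (auto simp: A_def)
  qed
  then obtain M where M: "\<And>c x. x \<in> A c \<Longrightarrow> M c x \<in> A c \<and> M c (M c x) = x"
      "\<And>c x y. x \<in> A c \<Longrightarrow> y \<in> A c \<Longrightarrow> M c x = x \<Longrightarrow> M c y = y \<Longrightarrow> x = y"
      "\<And>c. c \<in> K \<Longrightarrow> M c (p c) = p' c" by metis
  define \<mu> where "\<mu> x = M (col x) x" for x
  have muA: "\<mu> x = M c x" if "x \<in> A c" for x c using that by (auto simp: \<mu>_def A_def)
  have mu: "\<mu> x \<in> Z \<and> \<mu> (\<mu> x) = x" if "x \<in> Z" for x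
  proof -
    have x: "x \<in> A (col x)" using that by (simp add: A_def)
    from M(1)[OF this] muA[OF this] have "\<mu> x \<in> A (col x)" "M (col x) (\<mu> x) = x" by auto
    then show ?thesis using muA[of "\<mu> x" "col x"] by (auto simp: A_def)
  qed
  from two_matchings_bipartite[OF finZ tau mu] obtain b where
    b: "\<And>x. x \<in> Z \<Longrightarrow> b (?\<tau> x) = (\<not> b x)" "\<And>x. x \<in> Z \<Longrightarrow> \<mu> x \<noteq> x \<Longrightarrow> b (\<mu> x) = (\<not> b x)"
    by blast
  \<comment> \<open>\<open>b x\<close> means that the edge coloured like \<open>x\<close> is to
    contain \<open>v\<close>. Both \<open>b\<close> and membership of \<open>v\<close> flip under
    the transposition, so the two edges of a pair move together or not at all; hence
    \<open>\<phi>\<close> is an involution.\<close>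
  define \<phi> where "\<phi> x = (if x \<in> Z \<and> b x \<noteq> (v \<in> fst x) then ?\<tau> x else x)" for x
  have phiv: "v \<in> fst (\<phi> x) \<longleftrightarrow> b x" "w \<in> fst (\<phi> x) \<longleftrightarrow> \<not> b x" if "x \<in> Z" for x
    using that mem[of x] by (auto simp: \<phi>_def Z_def)
  show thesis
  proof
    show "\<phi> x \<in> E" if "x \<in> E" for x using that closed by (simp add: \<phi>_def)
    show "\<phi> (\<phi> x) = x" for x
    proof (cases "x \<in> Z \<and> b x \<noteq> (v \<in> fst x)")
      case True
      then have "?\<tau> x \<in> Z \<and> b (?\<tau> x) \<noteq> (v \<in> fst (?\<tau> x))"
        using tau b(1) mem[of x] by (auto simp: Z_def)
      then show ?thesis using True by (simp add: \<phi>_def)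
    qed (auto simp: \<phi>_def)
    show "\<phi> x = x \<or> \<phi> x = ?\<tau> x" for x by (simp add: \<phi>_def)
    show "\<phi> x = x" if "(v \<in> fst x) = (w \<in> fst x)" for x using that by (simp add: \<phi>_def Z_def)
    show "(v \<in> fst (\<phi> (p c))) \<noteq> (v \<in> fst (\<phi> (p' c)))" if "c \<in> K" for c
    proof -
      have "p c \<in> A c" using p[OF that] by (simp add: A_def)
      then have "\<mu> (p c) = p' c" using muA M(3)[OF that] by simp
      then show ?thesis using b(2)[of "p c"] p[OF that] phiv by auto
    qed
    show "\<bar>int (card {x \<in> Z. col x = c \<and> v \<in> fst (\<phi> x)}) -
        int (card {x \<in> Z. col x = c \<and> w \<in> fst (\<phi> x)})\<bar> \<le> 1" for c
    proof -
      have "{x \<in> Z. col x = c \<and> v \<in> fst (\<phi> x)} = {x \<in> A c. b x}"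
        "{x \<in> Z. col x = c \<and> w \<in> fst (\<phi> x)} = {x \<in> A c. \<not> b x}"
        using phiv by (auto simp: A_def)
      moreover have "\<bar>int (card {x \<in> A c. b x}) - int (card {x \<in> A c. \<not> b x})\<bar> \<le> 1"
      proof (rule balanced_by_pairing[where \<mu> = "M c"])
        show "finite (A c)" using finZ by (simp add: A_def)
        show "b (M c x) = (\<not> b x)" if "x \<in> A c" "M c x \<noteq> x" for x
          using that b(2)[of x] muA by (auto simp: A_def)
      qed (use M in blast)+
      ultimately show ?thesis by simp
    qed
  qed
qed

lemma colour_class_permute:
  assumes "\<And>x. x \<in> E \<Longrightarrow> \<phi> x \<in> E" "\<And>x. x \<in> E \<Longrightarrow> \<phi> (\<phi> x) = x"
  shows "{x \<in> E. col (\<phi> x) = c} = \<phi> ` {x \<in> E. col x = c}"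
proof
  show "{x \<in> E. col (\<phi> x) = c} \<subseteq> \<phi> ` {x \<in> E. col x = c}"
  proof
    fix x assume "x \<in> {x \<in> E. col (\<phi> x) = c}"
    then show "x \<in> \<phi> ` {x \<in> E. col x = c}"
      using assms by (intro image_eqI[of x \<phi> "\<phi> x"]) auto
  qed
qed (use assms in auto)

lemma resplit_colouring:
  fixes E :: "'a medge set" and col :: "'a medge \<Rightarrow> nat" and v w :: 'a
  assumes fin: "finite E" and vw: "v \<noteq> w" and closed: "\<And>x. x \<in> E \<Longrightarrow> swap_edge v w x \<in> E"
    and p: "\<And>c. c \<in> K \<Longrightarrow> p c \<in> E \<and> (v \<in> fst (p c)) \<noteq> (w \<in> fst (p c)) \<and> col (p c) = c \<and>
      p' c \<in> E \<and> (v \<in> fst (p' c)) \<noteq> (w \<in> fst (p' c)) \<and> col (p' c) = c \<and> p c \<noteq> p' c"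
  obtains \<phi> where "\<And>x. x \<in> E \<Longrightarrow> \<phi> x \<in> E" "\<And>x. x \<in> E \<Longrightarrow> \<phi> (\<phi> x) = x"
    "\<And>x. \<phi> x = x \<or> \<phi> x = swap_edge v w x"
    "\<And>x. (v \<in> fst x) = (w \<in> fst x) \<Longrightarrow> \<phi> x = x"
    "\<And>c. c \<in> K \<Longrightarrow> (v \<in> fst (\<phi> (p c))) \<noteq> (v \<in> fst (\<phi> (p' c)))"
    "\<And>c y. y \<noteq> v \<Longrightarrow> y \<noteq> w \<Longrightarrow>
      degree {x \<in> E. col (\<phi> x) = c} y = degree {x \<in> E. col x = c} y"
    "\<And>c. degree {x \<in> E. col (\<phi> x) = c} v + degree {x \<in> E. col (\<phi> x) = c} w =
      degree {x \<in> E. col x = c} v + degree {x \<in> E. col x = c} w"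
    "\<And>c. \<bar>int (degree {x \<in> E. col (\<phi> x) = c} v) - int (degree {x \<in> E. col (\<phi> x) = c} w)\<bar> \<le> 1"
proof -
  define Z where "Z = {x \<in> E. (v \<in> fst x) \<noteq> (w \<in> fst x)}"
  have p': "p c \<in> Z \<and> p' c \<in> Z \<and> p c \<noteq> p' c \<and> col (p c) = c \<and> col (p' c) = c"
    if "c \<in> K" for c using p[OF that] by (auto simp: Z_def)
  obtain \<phi> where phi: "\<And>x. x \<in> E \<Longrightarrow> \<phi> x \<in> E" "\<And>x. x \<in> E \<Longrightarrow> \<phi> (\<phi> x) = x"
    "\<And>x. \<phi> x = x \<or> \<phi> x = swap_edge v w x"
    "\<And>x. (v \<in> fst x) = (w \<in> fst x) \<Longrightarrow> \<phi> x = x"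
    "\<And>c. c \<in> K \<Longrightarrow> (v \<in> fst (\<phi> (p c))) \<noteq> (v \<in> fst (\<phi> (p' c)))"
    "\<And>c. \<bar>int (card {x \<in> Z. col x = c \<and> v \<in> fst (\<phi> x)}) -
        int (card {x \<in> Z. col x = c \<and> w \<in> fst (\<phi> x)})\<bar> \<le> 1"
    using resplit[of E v w K p p' col, folded Z_def, OF fin closed p'] by blast
  have finZ: "finite Z" using fin by (simp add: Z_def)
  have mem: "v \<in> fst (swap_edge v w x) \<longleftrightarrow> w \<in> fst x"
    "w \<in> fst (swap_edge v w x) \<longleftrightarrow> v \<in> fst x" for x
    by (auto simp: mem_swap_edge)
  have excl: "v \<in> fst (\<phi> x) \<longleftrightarrow> w \<notin> fst (\<phi> x)" if "x \<in> Z" for x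
    using that phi(3)[of x] mem[of x] by (auto simp: Z_def)
  have deg: "degree {x \<in> E. col (\<phi> x) = c} y = card {x \<in> E. col x = c \<and> y \<in> fst (\<phi> x)}" for c y
  proof -
    have "bij_betw \<phi> {x \<in> E. col x = c \<and> y \<in> fst (\<phi> x)} {x \<in> {x \<in> E. col (\<phi> x) = c}. y \<in> fst x}"
      by (rule bij_betwI[of _ _ _ \<phi>]) (use phi(1,2) in auto)
    from bij_betw_same_card[OF this] show ?thesis by (simp add: degree_def)
  qed
  \<comment> \<open>Edges through both vertices are fixed by \<open>\<phi>\<close> and count equally
    for \<open>v\<close> and \<open>w\<close>, so a balance on \<open>Z\<close> is a balance of
    degrees.\<close>
  define q where "q c = card {x \<in> E. col x = c \<and> v \<in> fst x \<and> w \<in> fst x}" for c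
  \<comment> \<open>The case \<open>id\<close> describes the old colouring, so one computation
    serves for both sides of the comparison.\<close>
  have split: "card {x \<in> E. col x = c \<and> y \<in> fst (\<psi> x)} =
      card {x \<in> Z. col x = c \<and> y \<in> fst (\<psi> x)} + q c"
    if "y = v \<or> y = w" and "\<psi> = \<phi> \<or> \<psi> = id" for c y \<psi>
  proof -
    have "\<psi> x = x" if "x \<notin> Z" "x \<in> E" for x
      using that \<open>\<psi> = \<phi> \<or> \<psi> = id\<close> phi(4)[of x] by (auto simp: Z_def)
    then have "y \<in> fst (\<psi> x) \<longleftrightarrow> v \<in> fst x \<and> w \<in> fst x" if "x \<notin> Z" "x \<in> E" for x
      using that \<open>y = v \<or> y = w\<close> by (auto simp: Z_def)
    moreover have "Z \<subseteq> E" "\<And>x. x \<in> Z \<Longrightarrow> \<not> (v \<in> fst x \<and> w \<in> fst x)"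
      by (auto simp: Z_def)
    ultimately have "{x \<in> E. col x = c \<and> y \<in> fst (\<psi> x)} = {x \<in> Z. col x = c \<and> y \<in> fst (\<psi> x)} \<union>
        {x \<in> E. col x = c \<and> v \<in> fst x \<and> w \<in> fst x}" by blast
    moreover have "{x \<in> Z. col x = c \<and> y \<in> fst (\<psi> x)} \<inter>
        {x \<in> E. col x = c \<and> v \<in> fst x \<and> w \<in> fst x} = {}" by (auto simp: Z_def)
    ultimately show ?thesis unfolding q_def using fin finZ by (simp add: card_Un_disjoint)
  qed
  have both: "card {x \<in> Z. col x = c \<and> v \<in> fst (\<psi> x)} + card {x \<in> Z. col x = c \<and> w \<in> fst (\<psi> x)} =
      card {x \<in> Z. col x = c}" if "\<psi> = \<phi> \<or> \<psi> = id" for c \<psi>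
  proof -
    have ex: "v \<in> fst (\<psi> x) \<longleftrightarrow> w \<notin> fst (\<psi> x)" if "x \<in> Z" for x
      using that excl[OF that] \<open>\<psi> = \<phi> \<or> \<psi> = id\<close> by (auto simp: Z_def)
    have "{x \<in> Z. col x = c} = {x \<in> Z. col x = c \<and> v \<in> fst (\<psi> x)} \<union> {x \<in> Z. col x = c \<and> w \<in> fst (\<psi> x)}"
      using ex by auto
    moreover have "{x \<in> Z. col x = c \<and> v \<in> fst (\<psi> x)} \<inter> {x \<in> Z. col x = c \<and> w \<in> fst (\<psi> x)} = {}"
      using ex by auto
    ultimately show ?thesis using finZ by (simp add: card_Un_disjoint)
  qed
  have old: "degree {x \<in> E. col x = c} y = card {x \<in> E. col x = c \<and> y \<in> fst x}" for c y
    by (simp add: degree_def conj_assoc)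
  show thesis
  proof
    show "degree {x \<in> E. col (\<phi> x) = c} y = degree {x \<in> E. col x = c} y"
      if "y \<noteq> v" "y \<noteq> w" for c y
    proof -
      have "y \<in> fst (\<phi> x) \<longleftrightarrow> y \<in> fst x" for x
        using phi(3)[of x] that by (auto simp: mem_swap_edge)
      then show ?thesis by (simp add: deg old)
    qed
    show "degree {x \<in> E. col (\<phi> x) = c} v + degree {x \<in> E. col (\<phi> x) = c} w =
      degree {x \<in> E. col x = c} v + degree {x \<in> E. col x = c} w" for c
      using split[of v \<phi> c] split[of w \<phi> c] split[of v id c] split[of w id c] both[of \<phi> c] both[of id c]
      by (simp add: deg old)
    show "\<bar>int (degree {x \<in> E. col (\<phi> x) = c} v) - int (degree {x \<in> E. col (\<phi> x) = c} w)\<bar> \<le> 1" for c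
      using phi(6)[of c] by (simp add: deg split)
  qed (use phi in blast)+
qed

section \<open>Balancing all colours at once\<close>

lemma sum_eq_if_pair_sum_eq:
  fixes f g :: "'a \<Rightarrow> 'b :: comm_monoid_add"
  assumes "finite S" "v \<noteq> w" "v \<in> S \<longleftrightarrow> w \<in> S"
    and "\<And>y. y \<noteq> v \<Longrightarrow> y \<noteq> w \<Longrightarrow> f y = g y" "f v + f w = g v + g w"
  shows "sum f S = sum g S"
proof (cases "v \<in> S")
  case True
  then have S: "S = insert v (insert w (S - {v, w}))" using assms(3) by auto
  have "sum h S = (h v + h w) + sum h (S - {v, w})" for h :: "'a \<Rightarrow> 'b"
    by (subst S) (use assms(1,2) in \<open>simp add: add.assoc\<close>)
  moreover have "sum f (S - {v, w}) = sum g (S - {v, w})" using assms(4) by (intro sum.cong) auto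
  ultimately show ?thesis using assms(5) by simp
next
  case False
  then show ?thesis using assms(3,4) by (metis sum.cong)
qed

text \<open>By 2 (x^2 + y^2) = (x + y)^2 + (x - y)^2, a fixed sum leaves only the difference to
  compare, and a difference of at most 1 is the least that the parity of the sum allows.\<close>

lemma sum_squares_le_if_balanced:
  fixes a b a' b' :: nat
  assumes sum: "a' + b' = a + b" and le: "\<bar>int a' - int b'\<bar> \<le> 1"
  shows "a'\<^sup>2 + b'\<^sup>2 \<le> a\<^sup>2 + b\<^sup>2"
    and "\<bar>int a - int b\<bar> > 1 \<Longrightarrow> a'\<^sup>2 + b'\<^sup>2 < a\<^sup>2 + b\<^sup>2"
proof -
  have two: "2 * int (x\<^sup>2 + y\<^sup>2) = (int (x + y))\<^sup>2 + \<bar>int x - int y\<bar>\<^sup>2" for x y :: nat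
    by (simp add: power2_eq_square algebra_simps)
  have diff: "2 * int (a\<^sup>2 + b\<^sup>2) - 2 * int (a'\<^sup>2 + b'\<^sup>2) = \<bar>int a - int b\<bar>\<^sup>2 - \<bar>int a' - int b'\<bar>\<^sup>2"
    by (simp only: two sum add_diff_add diff_self add_0)
  have mono: "S \<le> R \<Longrightarrow> Q \<le> P" "S < R \<Longrightarrow> Q < P" if "2 * P - 2 * Q = R - S" for P Q R S :: int
    using that by linarith+
  have "\<bar>int a' - int b'\<bar> \<le> \<bar>int a - int b\<bar>"
  proof (cases "a = b")
    case True
    then have "a' \<noteq> Suc b'" "b' \<noteq> Suc a'" using sum by presburger+
    then show ?thesis using le by linarith
  next
    case False
    then show ?thesis using le by linarith
  qed
  then have "\<bar>int a' - int b'\<bar>\<^sup>2 \<le> \<bar>int a - int b\<bar>\<^sup>2" by (intro power_mono) auto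
  from mono(1)[OF diff this] have "int (a'\<^sup>2 + b'\<^sup>2) \<le> int (a\<^sup>2 + b\<^sup>2)" .
  then show "a'\<^sup>2 + b'\<^sup>2 \<le> a\<^sup>2 + b\<^sup>2" by (simp only: of_nat_le_iff)
  show "a'\<^sup>2 + b'\<^sup>2 < a\<^sup>2 + b\<^sup>2" if "\<bar>int a - int b\<bar> > 1"
  proof -
    have "\<bar>int a' - int b'\<bar>\<^sup>2 < \<bar>int a - int b\<bar>\<^sup>2"
      using le that by (intro power_strict_mono) auto
    from mono(2)[OF diff this] have "int (a'\<^sup>2 + b'\<^sup>2) < int (a\<^sup>2 + b\<^sup>2)" .
    then show ?thesis by (simp only: of_nat_less_iff)
  qed
qed

text \<open>Minimising the sum of the squares of all degrees: re-splitting two vertices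
  balances their degrees in every colour at once and changes no other degree.\<close>

lemma balanced_colouring:
  fixes E :: "'a medge set" and col :: "'a medge \<Rightarrow> nat" and side :: "'a \<Rightarrow> 'b"
  assumes "finite V" "finite E" and "\<And>x. x \<in> E \<Longrightarrow> col x < k"
    and closed: "\<And>v w x. v \<in> V \<Longrightarrow> w \<in> V \<Longrightarrow> side v = side w \<Longrightarrow> x \<in> E \<Longrightarrow> swap_edge v w x \<in> E"
  obtains col' where "\<And>x. x \<in> E \<Longrightarrow> col' x < k"
    "\<And>c a. (\<Sum>y | y \<in> V \<and> side y = a. degree {x \<in> E. col' x = c} y) =
      (\<Sum>y | y \<in> V \<and> side y = a. degree {x \<in> E. col x = c} y)"
    "\<And>c v w. v \<in> V \<Longrightarrow> w \<in> V \<Longrightarrow> side v = side w \<Longrightarrow>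
      \<bar>int (degree {x \<in> E. col' x = c} v) - int (degree {x \<in> E. col' x = c} w)\<bar> \<le> 1"
proof -
  define d where "d f c y = degree {x \<in> E. f x = c} y" for f :: "'a medge \<Rightarrow> nat" and c y
  define S where "S a = {y. y \<in> V \<and> side y = a}" for a
  define Q where "Q f \<longleftrightarrow> (\<forall>x\<in>E. f x < k) \<and> (\<forall>c a. sum (d f c) (S a) = sum (d col c) (S a))"
    for f :: "'a medge \<Rightarrow> nat"
  define \<Phi> where "\<Phi> f = (\<Sum>c<k. \<Sum>y\<in>V. (d f c y)\<^sup>2)" for f :: "'a medge \<Rightarrow> nat"
  have "Q col" using assms(3) by (simp add: Q_def)
  from ex_has_least_nat[of Q, OF this, of \<Phi>] obtain f where
    f: "Q f" "\<And>g. Q g \<Longrightarrow> \<Phi> f \<le> \<Phi> g" by blast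
  have fS: "finite (S a)" for a using assms(1) by (simp add: S_def)
  have bal: "\<bar>int (d f c v) - int (d f c w)\<bar> \<le> 1"
    if v: "v \<in> V" and w: "w \<in> V" and vw: "side v = side w" for c v w
  proof (rule ccontr)
    assume big: "\<not> \<bar>int (d f c v) - int (d f c w)\<bar> \<le> 1"
    then have "v \<noteq> w" by auto
    \<comment> \<open>The potential counts only colours below \<open>k\<close>; the unbalanced
      colour must be one of them, since all other classes are empty.\<close>
    have "c < k"
    proof (rule ccontr)
      assume "\<not> c < k"
      then have empty: "{x \<in> E. f x = c} = {}" using f(1) by (auto simp: Q_def)
      have "d f c y = 0" for y unfolding d_def empty by (simp add: degree_def)
      then show False using big by simp
    qed
    obtain \<phi> where phi0: "\<And>x. x \<in> E \<Longrightarrow> \<phi> x \<in> E"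
      "\<And>c y. y \<noteq> v \<Longrightarrow> y \<noteq> w \<Longrightarrow>
        degree {x \<in> E. f (\<phi> x) = c} y = degree {x \<in> E. f x = c} y"
      "\<And>c. degree {x \<in> E. f (\<phi> x) = c} v + degree {x \<in> E. f (\<phi> x) = c} w =
        degree {x \<in> E. f x = c} v + degree {x \<in> E. f x = c} w"
      "\<And>c. \<bar>int (degree {x \<in> E. f (\<phi> x) = c} v) - int (degree {x \<in> E. f (\<phi> x) = c} w)\<bar> \<le> 1"
    proof -
      show thesis
      proof (rule resplit_colouring[OF assms(2) \<open>v \<noteq> w\<close> closed[OF v w vw], where K = "{}"
            and col = f and p = undefined and p' = undefined], assumption, goal_cases)
        case (1 c)
        then show ?case by simp
      next
        case (2 \<phi>)
        show ?case by (rule that[OF 2(1,6,7,8)])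
      qed
    qed
    have phi: "\<And>x. x \<in> E \<Longrightarrow> \<phi> x \<in> E"
      "\<And>c y. y \<noteq> v \<Longrightarrow> y \<noteq> w \<Longrightarrow> d (f \<circ> \<phi>) c y = d f c y"
      "\<And>c. d (f \<circ> \<phi>) c v + d (f \<circ> \<phi>) c w = d f c v + d f c w"
      "\<And>c. \<bar>int (d (f \<circ> \<phi>) c v) - int (d (f \<circ> \<phi>) c w)\<bar> \<le> 1"
      unfolding d_def comp_def using phi0 by blast+
    have "Q (f \<circ> \<phi>)"
      unfolding Q_def
    proof (intro conjI ballI allI)
      show "(f \<circ> \<phi>) x < k" if "x \<in> E" for x using f(1) phi(1)[OF that] by (simp add: Q_def)
      show "sum (d (f \<circ> \<phi>) c) (S a) = sum (d col c) (S a)" for c a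
      proof -
        have "sum (d (f \<circ> \<phi>) c) (S a) = sum (d f c) (S a)"
          by (rule sum_eq_if_pair_sum_eq[OF fS \<open>v \<noteq> w\<close>]) (use v w vw phi in \<open>auto simp: S_def\<close>)
        then show ?thesis using f(1) by (simp add: Q_def)
      qed
    qed
    moreover have "\<Phi> (f \<circ> \<phi>) < \<Phi> f"
    proof -
      have V: "V = insert v (insert w (V - {v, w}))" using v w by auto
      have sV: "sum h V = (h v + h w) + sum h (V - {v, w})" for h :: "'a \<Rightarrow> nat"
        by (subst V) (use assms(1) \<open>v \<noteq> w\<close> in simp)
      have rest: "(\<Sum>y\<in>V - {v, w}. (d (f \<circ> \<phi>) c y)\<^sup>2) = (\<Sum>y\<in>V - {v, w}. (d f c y)\<^sup>2)" for c
        using phi(2) by (intro sum.cong) auto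
      show ?thesis
        unfolding \<Phi>_def
      proof (rule sum_strict_mono_ex1)
        show "\<forall>c\<in>{..<k}. (\<Sum>y\<in>V. (d (f \<circ> \<phi>) c y)\<^sup>2) \<le> (\<Sum>y\<in>V. (d f c y)\<^sup>2)"
          using sum_squares_le_if_balanced(1)[OF phi(3,4)] by (simp only: sV rest) simp
        have "(\<Sum>y\<in>V. (d (f \<circ> \<phi>) c y)\<^sup>2) < (\<Sum>y\<in>V. (d f c y)\<^sup>2)"
          using sum_squares_le_if_balanced(2)[OF phi(3,4), of c] big by (simp only: sV rest) simp
        then show "\<exists>c\<in>{..<k}. (\<Sum>y\<in>V. (d (f \<circ> \<phi>) c y)\<^sup>2) < (\<Sum>y\<in>V. (d f c y)\<^sup>2)"
          using \<open>c < k\<close> by blast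
      qed simp
    qed
    ultimately show False using f(2) by (meson linorder_not_le)
  qed
  show thesis
  proof (rule that[of f])
    show "f x < k" if "x \<in> E" for x using f(1) that by (simp add: Q_def)
  qed (use f(1) bal in \<open>auto simp: Q_def d_def S_def fun_eq_iff\<close>)
qed

text \<open>The mean is the integer \<open>a\<close>. One value below it forces all values to be at
  most \<open>a\<close>, so the sum is too small; likewise above. Thus balanced degrees with the
  right sum are constant.\<close>

lemma balanced_sum_eq:
  fixes f :: "'a \<Rightarrow> nat"
  assumes "finite S" "sum f S = a * card S"
    and "\<And>v w. v \<in> S \<Longrightarrow> w \<in> S \<Longrightarrow> \<bar>int (f v) - int (f w)\<bar> \<le> 1"
    and "v \<in> S"
  shows "f v = a"
proof (rule ccontr)
  assume "f v \<noteq> a"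
  have c: "(\<Sum>w\<in>S. a) = a * card S" by simp
  consider "f v < a" | "f v > a" using \<open>f v \<noteq> a\<close> by linarith
  then show False
  proof cases
    case 1
    have "f w \<le> a" if "w \<in> S" for w using assms(3)[OF assms(4) that] 1 by linarith
    then have "sum f S < (\<Sum>w\<in>S. a)"
      using 1 assms(1,4) by (intro sum_strict_mono_ex1) auto
    then show False using c assms(2) by simp
  next
    case 2
    have "a \<le> f w" if "w \<in> S" for w using assms(3)[OF assms(4) that] 2 by linarith
    then have "(\<Sum>w\<in>S. a) < sum f S"
      using 2 assms(1,4) by (intro sum_strict_mono_ex1) auto
    then show False using c assms(2) by simp
  qed
qed

section \<open>Connecting the factors\<close>

text \<open>Deleting the vertices \<open>X\<close> shrinks the edges through them but keeps these edges.\<close>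

definition reach :: "'a set \<Rightarrow> 'a medge set \<Rightarrow> ('a \<times> 'a) set" where
  "reach X H = {(x, y). \<exists>e\<in>H. x \<in> fst e - X \<and> y \<in> fst e - X}\<^sup>*"

lemma hconnected_iff_reach: "hconnected V H \<longleftrightarrow> (\<forall>u\<in>V. \<forall>v\<in>V. (u, v) \<in> reach {} H)"
  by (simp add: hconnected_def reach_def)

lemma reach_refl [simp]: "(x, x) \<in> reach X H"
  by (simp add: reach_def)

lemma reach_trans: "(x, y) \<in> reach X H \<Longrightarrow> (y, z) \<in> reach X H \<Longrightarrow> (x, z) \<in> reach X H"
  unfolding reach_def by (rule rtrancl_trans)

lemma reach_sym: "(x, y) \<in> reach X H \<Longrightarrow> (y, x) \<in> reach X H"
proof -
  have "sym (reach X H)" unfolding reach_def by (rule sym_rtrancl) (auto simp: sym_def)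
  then show "(x, y) \<in> reach X H \<Longrightarrow> (y, x) \<in> reach X H" by (rule symD)
qed

lemma reach_edge: "e \<in> H \<Longrightarrow> x \<in> fst e - X \<Longrightarrow> y \<in> fst e - X \<Longrightarrow> (x, y) \<in> reach X H"
  unfolding reach_def by (rule r_into_rtrancl) blast

lemma reach_induct [consumes 1, case_names refl step]:
  assumes "(a, b) \<in> reach X H" and "P a"
    and "\<And>y z e. (a, y) \<in> reach X H \<Longrightarrow> e \<in> H \<Longrightarrow> y \<in> fst e - X \<Longrightarrow> z \<in> fst e - X \<Longrightarrow> P y \<Longrightarrow> P z"
  shows "P b"
  using assms(1) unfolding reach_def
  by (induction rule: rtrancl_induct) (use assms(2,3) in \<open>auto simp: reach_def\<close>)

lemma reach_mono: "X \<subseteq> Y \<Longrightarrow> reach Y H \<subseteq> reach X H"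
  unfolding reach_def by (rule rtrancl_mono) blast

lemma reach_notin: "(a, b) \<in> reach X H \<Longrightarrow> a \<notin> X \<Longrightarrow> b \<notin> X"
  by (induction rule: reach_induct) auto

lemma reach_in: "(a, b) \<in> reach X H \<Longrightarrow> a \<in> V \<Longrightarrow> (\<And>e. e \<in> H \<Longrightarrow> fst e \<subseteq> V) \<Longrightarrow> b \<in> V"
  by (induction rule: reach_induct) auto

text \<open>Every vertex of a walk from \<open>a\<close> is itself reachable from \<open>a\<close>,
  so the walk cannot meet \<open>Y\<close>.\<close>

lemma reach_avoid_more:
  assumes "(a, b) \<in> reach X H" and "\<And>z. (a, z) \<in> reach X H \<Longrightarrow> z \<notin> Y"
  shows "(a, b) \<in> reach (X \<union> Y) H"
  using assms(1)
proof (induction rule: reach_induct)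
  case (step y z e)
  have "(a, z) \<in> reach X H" using step(1-4) reach_edge reach_trans by metis
  then have "z \<notin> Y" "y \<notin> Y" using assms(2) step(1) by auto
  then have "(y, z) \<in> reach (X \<union> Y) H" using step by (intro reach_edge[of e]) auto
  then show ?case using step(5) by (rule reach_trans[rotated])
qed simp

text \<open>If every two edges at a vertex outside \<open>U\<close> were separated by that vertex, a smallest
  branch hanging at such a vertex could neither contain a further vertex outside \<open>U\<close> nor lie
  inside \<open>U\<close>.\<close>

lemma two_edges_on_a_cycle:
  fixes H :: "'a medge set"
  assumes "finite V"
    and edges: "\<And>e. e \<in> H \<Longrightarrow> fst e \<subseteq> V \<and> card (fst e) = 3"
    and two: "\<And>y. y \<in> V \<Longrightarrow> \<exists>e1\<in>H. \<exists>e2\<in>H. e1 \<noteq> e2 \<and> y \<in> fst e1 \<and> y \<in> fst e2"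
    and out: "\<And>u. u \<in> V \<Longrightarrow> u \<in> U \<Longrightarrow> \<exists>e\<in>H. u \<in> fst e \<and> \<not> fst e \<subseteq> U"
    and x0: "x0 \<in> V - U"
  obtains x e1 e2 a1 a2 where "x \<in> V - U" "(x0, x) \<in> reach {} H" "e1 \<in> H" "e2 \<in> H" "e1 \<noteq> e2"
    "x \<in> fst e1" "x \<in> fst e2" "a1 \<in> fst e1 - {x}" "a2 \<in> fst e2 - {x}" "(a1, a2) \<in> reach {x} H"
proof (rule ccontr)
  note found = that
  assume neg: "\<not> thesis"
  have tree: False
    if "x \<in> V - U" "(x0, x) \<in> reach {} H" "e1 \<in> H" "e2 \<in> H" "e1 \<noteq> e2"
      "x \<in> fst e1" "x \<in> fst e2" "a1 \<in> fst e1 - {x}" "a2 \<in> fst e2 - {x}" "(a1, a2) \<in> reach {x} H"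
    for x e1 e2 a1 a2
    by (rule notE[OF neg], rule found[OF that])
  \<comment> \<open>The branch at \<open>x\<close> through \<open>e\<close>: what can still be
    reached from \<open>e\<close> once \<open>x\<close> is deleted. The pair (x, e) is chosen with
    the smallest branch, for \<open>x\<close> outside \<open>U\<close> in the component of
    \<open>x0\<close>.\<close>
  define B where "B x e = {b. \<exists>a\<in>fst e - {x}. (a, b) \<in> reach {x} H}" for x and e :: "'a medge"
  define P where "P z \<longleftrightarrow> fst z \<in> V - U \<and> (x0, fst z) \<in> reach {} H \<and> snd z \<in> H \<and> fst z \<in> fst (snd z)"
    for z :: "'a \<times> 'a medge"
  obtain e0 where "e0 \<in> H" "x0 \<in> fst e0" using two x0 by blast
  then have "P (x0, e0)" using x0 by (simp add: P_def)
  from ex_has_least_nat[of P, OF this, of "\<lambda>z. card (B (fst z) (snd z))"] obtain x e where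
    Px: "P (x, e)" and least: "\<And>y f. P (y, f) \<Longrightarrow> card (B x e) \<le> card (B y f)" by auto
  have x: "x \<in> V" "x \<notin> U" "(x0, x) \<in> reach {} H" and e: "e \<in> H" "x \<in> fst e"
    using Px by (auto simp: P_def)
  have BV: "B x e \<subseteq> V" using reach_in[of _ _ "{x}" H V] edges e(1) unfolding B_def by blast
  have finB: "finite (B x e)" using BV assms(1) by (rule finite_subset)
  have xB: "x \<notin> B x e" using reach_notin[of _ _ "{x}" H] unfolding B_def by blast
  have step: "z \<in> B x e" if "d \<in> B x e" "f \<in> H" "d \<in> fst f" "z \<in> fst f" "z \<noteq> x" for d f z
  proof -
    have "(d, z) \<in> reach {x} H" using that xB by (intro reach_edge[of f]) auto
    then show ?thesis using that(1) reach_trans[of _ d "{x}" H z] unfolding B_def by blast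
  qed
  \<comment> \<open>A second edge at \<open>x\<close> touching the branch would be joined to
    \<open>e\<close> away from \<open>x\<close>, which is the configuration assumed absent.\<close>
  have onlye: "f = e" if dB: "d \<in> B x e" and df: "f \<in> H" "d \<in> fst f" "x \<in> fst f" for d f
  proof (rule ccontr)
    assume "f \<noteq> e"
    obtain a where "a \<in> fst e - {x}" "(a, d) \<in> reach {x} H" using dB unfolding B_def by blast
    moreover have "d \<in> fst f - {x}" using dB df xB by auto
    ultimately show False using tree[of x e f a d] x e df \<open>f \<noteq> e\<close> by blast
  qed
  \<comment> \<open>A vertex \<open>y\<close> of the branch outside \<open>U\<close> has an edge
    \<open>f\<close> that leads away from \<open>x\<close>. The branch at \<open>y\<close> through
    \<open>f\<close> lies in the branch of \<open>x\<close> and misses \<open>y\<close>, contrary to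
    minimality.\<close>
  have "B x e \<subseteq> U"
  proof (rule ccontr)
    assume "\<not> B x e \<subseteq> U"
    then obtain y where y: "y \<in> B x e" "y \<notin> U" by blast
    have "y \<in> V" "y \<noteq> x" using y BV xB by auto
    obtain f1 f2 where f12: "f1 \<in> H" "f2 \<in> H" "f1 \<noteq> f2" "y \<in> fst f1" "y \<in> fst f2"
      using two[OF \<open>y \<in> V\<close>] by blast
    obtain a0 where a0: "a0 \<in> fst e - {x}" "(a0, y) \<in> reach {x} H" using y(1) by (auto simp: B_def)
    have "(x, a0) \<in> reach {} H" using a0(1) e by (intro reach_edge[of e]) auto
    moreover have "(a0, y) \<in> reach {} H" using a0(2) reach_mono[of "{}" "{x}" H] by auto
    ultimately have x0y: "(x0, y) \<in> reach {} H" using x(3) by (blast intro: reach_trans)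
    \<comment> \<open>If \<open>x\<close> were in both branches, \<open>f1\<close> and
      \<open>f2\<close> would be joined through \<open>x\<close> away from \<open>y\<close>.\<close>
    have "x \<notin> B y f1 \<or> x \<notin> B y f2"
    proof (rule ccontr)
      assume "\<not> (x \<notin> B y f1 \<or> x \<notin> B y f2)"
      then obtain a1 a2 where "a1 \<in> fst f1 - {y}" "(a1, x) \<in> reach {y} H"
        "a2 \<in> fst f2 - {y}" "(a2, x) \<in> reach {y} H" by (auto simp: B_def)
      moreover from this have "(a1, a2) \<in> reach {y} H" by (blast intro: reach_trans reach_sym)
      ultimately show False using tree[of y f1 f2 a1 a2] f12 y(2) \<open>y \<in> V\<close> x0y by blast
    qed
    then obtain f where f: "f \<in> H" "y \<in> fst f" "x \<notin> B y f" using f12 by blast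
    have "B y f \<subseteq> B x e"
    proof
      fix z assume "z \<in> B y f"
      then obtain a where a: "a \<in> fst f - {y}" "(a, z) \<in> reach {y} H" by (auto simp: B_def)
      then have ax: "t \<noteq> x" if "(a, t) \<in> reach {y} H" for t using f(3) that by (auto simp: B_def)
      then have "(a, z) \<in> reach ({y} \<union> {x}) H" using a(2) by (intro reach_avoid_more) auto
      then have "(a, z) \<in> reach {x} H" using reach_mono[of "{x}" "{y} \<union> {x}" H] by auto
      moreover have "a \<in> B x e" using step[OF y(1) f(1,2)] a(1) ax[of a] by auto
      ultimately show "z \<in> B x e" unfolding B_def using reach_trans by fast
    qed
    moreover have "y \<notin> B y f" using reach_notin[of _ _ "{y}" H] unfolding B_def by blast
    ultimately have "card (B y f) < card (B x e)" using y(1) finB by (intro psubset_card_mono) auto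
    moreover have "P (y, f)" using \<open>y \<in> V\<close> y(2) x0y f by (simp add: P_def)
    ultimately show False using least by (meson linorder_not_le)
  qed
  have "finite (fst e)" using edges[OF e(1)] assms(1) finite_subset by blast
  then have "card (fst e - {x}) = 2" using edges[OF e(1)] e(2) by simp
  then obtain a where a: "a \<in> fst e - {x}" by (metis card.empty all_not_in_conv zero_neq_numeral)
  then have aB: "a \<in> B x e" using reach_refl[of a "{x}" H] unfolding B_def by blast
  then obtain f where f: "f \<in> H" "f \<noteq> e" "a \<in> fst f" using two BV by blast
  then have "x \<notin> fst f" using onlye aB by blast
  then have fB: "fst f \<subseteq> B x e" using step[OF aB f(1,3)] by blast
  \<comment> \<open>The vertex \<open>a\<close> leaves \<open>U\<close> by \<open>e\<close> itself,
    so it gives no contradiction; a vertex of the branch outside \<open>e\<close> is needed. Since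
    \<open>f\<close> has three vertices and avoids \<open>x\<close>, it does not fit into the two
    vertices of \<open>e\<close> other than \<open>x\<close>.\<close>
  have "\<not> fst f \<subseteq> fst e - {x}"
    using card_mono[of "fst e - {x}" "fst f"] \<open>card (fst e - {x}) = 2\<close> edges[OF f(1)] \<open>finite (fst e)\<close>
    by auto
  then obtain d where d: "d \<in> fst f" "d \<notin> fst e" using \<open>x \<notin> fst f\<close> by blast
  have dB: "d \<in> B x e" using fB d by blast
  then obtain g where g: "g \<in> H" "d \<in> fst g" "\<not> fst g \<subseteq> U"
    using out BV \<open>B x e \<subseteq> U\<close> by blast
  have "x \<notin> fst g" using onlye[OF dB g(1,2)] g(2) d(2) by blast
  then have "fst g \<subseteq> B x e" using step[OF dB g(1,2)] by blast
  then show False using g(3) \<open>B x e \<subseteq> U\<close> by blast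
qed

section \<open>Components under a re-split\<close>

text \<open>The connection between \<open>p\<close> and \<open>p'\<close> uses neither
  \<open>v\<close> nor \<open>w\<close>, so a re-split cannot destroy it. If the re-split sends one
  of the edges to \<open>v\<close> and the other to \<open>w\<close>, then \<open>v\<close> and
  \<open>w\<close> become connected. Both edges may be at the same vertex beforehand.\<close>

definition linked :: "'a \<Rightarrow> 'a \<Rightarrow> 'a medge set \<Rightarrow> 'a medge \<Rightarrow> 'a medge \<Rightarrow> bool" where
  "linked v w H p p' \<longleftrightarrow> p \<in> H \<and> p' \<in> H \<and> p \<noteq> p' \<and> (v \<in> fst p) \<noteq> (w \<in> fst p) \<and>
    (v \<in> fst p') \<noteq> (w \<in> fst p') \<and>
    (\<exists>a\<in>fst p - {v, w}. \<exists>a'\<in>fst p' - {v, w}. (a, a') \<in> reach {v, w} H)"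

text \<open>On a walk from \<open>v\<close> to \<open>w\<close>, the last edge leaving
  \<open>v\<close> before \<open>w\<close> is first met and the edge arriving at \<open>w\<close>
  are linked, unless they are the same edge. Hence any existing connection can be protected: a
  common edge never moves, and a linked pair can be forced apart.\<close>

lemma common_edge_or_linked_if_reach:
  assumes "(v, w) \<in> reach {} H" "v \<noteq> w"
  shows "(\<exists>e\<in>H. v \<in> fst e \<and> w \<in> fst e) \<or> (\<exists>p p'. linked v w H p p')"
proof (rule ccontr)
  assume neg: "\<not> ?thesis"
  \<comment> \<open>Without a common edge or a linked pair, the walk never gets to \<open>w\<close>:
    every vertex other than \<open>v\<close> is joined, off \<open>v\<close> and \<open>w\<close>,
    to an edge at \<open>v\<close>.\<close>
  have "z = v \<or> (z \<noteq> w \<and> z \<noteq> v \<and>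
      (\<exists>e\<in>H. v \<in> fst e \<and> (\<exists>a\<in>fst e - {v, w}. (a, z) \<in> reach {v, w} H)))"
    if "(v, z) \<in> reach {} H" for z
    using that
  proof (induction rule: reach_induct)
    case (step y z e)
    show ?case
    proof (cases "v \<in> fst e")
      case True
      then have "z \<noteq> w" using neg step by blast
      then show ?thesis using True step.hyps(2-4) reach_refl[of z "{v, w}" H] by blast
    next
      case False
      then have y: "y \<noteq> v" using step by blast
      then obtain f a where f: "f \<in> H" "v \<in> fst f" "a \<in> fst f - {v, w}" "(a, y) \<in> reach {v, w} H" "y \<noteq> w"
        using step by blast
      have "z \<noteq> v" using False step by blast
      moreover have "z \<noteq> w"
      proof
        assume "z = w"
        then have "linked v w H f e" unfolding linked_def using f y step False neg by blast
        then show False using neg by blast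
      qed
      moreover have "(y, z) \<in> reach {v, w} H"
        using step y f(5) \<open>z \<noteq> v\<close> \<open>z \<noteq> w\<close> by (intro reach_edge[of e]) auto
      ultimately show ?thesis using f reach_trans by metis
    qed
  qed simp
  from this[OF assms(1)] show False using assms(2) by auto
qed

text \<open>\<open>H\<close> and \<open>H'\<close> stand for one colour class before and after a
  re-split; connectivity is studied one colour at a time.\<close>

locale edge_moves =
  fixes v w :: 'a and H H' :: "'a medge set" and \<phi> :: "'a medge \<Rightarrow> 'a medge"
  assumes H': "H' = \<phi> ` H" and move: "\<And>x. \<phi> x = x \<or> \<phi> x = swap_edge v w x"
begin

lemma mem_moved: "z \<noteq> v \<Longrightarrow> z \<noteq> w \<Longrightarrow> z \<in> fst (\<phi> x) \<longleftrightarrow> z \<in> fst x"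
  using move[of x] by (auto simp: mem_swap_edge)

lemma moved_pair: "v \<in> fst (\<phi> x) \<or> w \<in> fst (\<phi> x)" if "v \<in> fst x \<or> w \<in> fst x"
  using move[of x] that by (auto simp: mem_swap_edge)

text \<open>The moves become invisible when \<open>v\<close> and \<open>w\<close> are merged into
  one vertex. So a walk can break only where it passes through one of these two, and it then ends
  and restarts in {v, w}.\<close>

lemma reach_moved:
  assumes "(x, y) \<in> reach {} H"
  shows "(x, y) \<in> reach {} H' \<or> (\<exists>a\<in>{v, w}. \<exists>b\<in>{v, w}. (x, a) \<in> reach {} H' \<and> (b, y) \<in> reach {} H')"
  using assms
proof (induction rule: reach_induct)
  case (step y z e)
  have e': "\<phi> e \<in> H'" using step(2) H' by blast
  show ?case
  proof (cases "y \<in> {v, w}")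
    case True
    then obtain a where a: "a \<in> {v, w}" "(x, a) \<in> reach {} H'" using step.IH by blast
    obtain b where b: "b \<in> {v, w}" "b \<in> fst (\<phi> e)" using moved_pair[of e] True step(3) by blast
    show ?thesis
    proof (cases "z \<in> {v, w}")
      case True
      then show ?thesis using a reach_refl[of z "{}" H'] by blast
    next
      case False
      then have "(b, z) \<in> reach {} H'"
        using mem_moved[of z e] step(4) b(2) e' by (intro reach_edge[of "\<phi> e"]) auto
      then show ?thesis using a b by blast
    qed
  next
    case yn: False
    then have y': "y \<in> fst (\<phi> e)" using mem_moved[of y e] step(3) by blast
    have "(y, z) \<in> reach {} H' \<or> (z \<in> {v, w} \<and> (\<exists>a\<in>{v, w}. (y, a) \<in> reach {} H'))"
    proof (cases "z \<in> {v, w}")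
      case True
      obtain b where b: "b \<in> {v, w}" "b \<in> fst (\<phi> e)" using moved_pair[of e] True step(4) by blast
      then have "(y, b) \<in> reach {} H'" using y' e' by (intro reach_edge[of "\<phi> e"]) auto
      then show ?thesis using True b by blast
    next
      case False
      then have "(y, z) \<in> reach {} H'"
        using mem_moved[of z e] step(4) y' e' by (intro reach_edge[of "\<phi> e"]) auto
      then show ?thesis by blast
    qed
    then show ?thesis using step.IH reach_trans[of _ y "{}" H'] reach_refl[of z "{}" H'] by blast
  qed
qed simp

lemma reach_avoiding_moved: "reach {v, w} H \<subseteq> reach {} H'"
proof
  fix z assume "z \<in> reach {v, w} H"
  then obtain x y where z: "z = (x, y)" "(x, y) \<in> reach {v, w} H" by (cases z) auto
  from z(2) have "(x, y) \<in> reach {} H'"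
  proof (induction rule: reach_induct)
    case (step y z e)
    have "(y, z) \<in> reach {} H'"
      using mem_moved[of y e] mem_moved[of z e] step(2-4) H' by (intro reach_edge[of "\<phi> e"]) auto
    then show ?case using step.IH reach_trans by metis
  qed simp
  then show "z \<in> reach {} H'" using z by simp
qed

lemma reach_pair_moved:
  assumes "linked v w H p p'" and "(v \<in> fst (\<phi> p)) \<noteq> (v \<in> fst (\<phi> p'))"
  shows "(v, w) \<in> reach {} H'"
proof -
  obtain a a' where a: "a \<in> fst p - {v, w}" "a' \<in> fst p' - {v, w}" "(a, a') \<in> reach {v, w} H"
    and p: "p \<in> H" "p' \<in> H" "v \<in> fst p \<or> w \<in> fst p" "v \<in> fst p' \<or> w \<in> fst p'"
    using assms(1) by (auto simp: linked_def)
  have aa: "(a, a') \<in> reach {} H'" using a(3) reach_avoiding_moved by blast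
  have r: "(z, b) \<in> reach {} H'" if "e \<in> H" "z \<in> fst (\<phi> e)" "b \<in> fst e - {v, w}" for z b e
    using that mem_moved[of b e] H' by (intro reach_edge[of "\<phi> e"]) auto
  show ?thesis
  proof (cases "v \<in> fst (\<phi> p)")
    case True
    then have "w \<in> fst (\<phi> p')" using assms(2) moved_pair[OF p(4)] by blast
    then have "(v, a) \<in> reach {} H'" "(w, a') \<in> reach {} H'" using r p a True by blast+
    then show ?thesis using aa reach_trans reach_sym by metis
  next
    case False
    then have "w \<in> fst (\<phi> p)" "v \<in> fst (\<phi> p')" using assms(2) moved_pair[OF p(3)] by blast+
    then have "(w, a) \<in> reach {} H'" "(v, a') \<in> reach {} H'" using r p a by blast+
    then show ?thesis using aa reach_trans reach_sym by metis
  qed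
qed

end

text \<open>The number of components, as the least size of a set of vertices meeting all of them.\<close>

definition spans :: "'a set \<Rightarrow> 'a medge set \<Rightarrow> 'a set \<Rightarrow> bool" where
  "spans V H T \<longleftrightarrow> T \<subseteq> V \<and> (\<forall>x\<in>V. \<exists>t\<in>T. (t, x) \<in> reach {} H)"

definition components :: "'a set \<Rightarrow> 'a medge set \<Rightarrow> nat" where
  "components V H = (LEAST j. \<exists>T. spans V H T \<and> card T = j)"

lemma components_le: "spans V H T \<Longrightarrow> components V H \<le> card T"
  unfolding components_def by (rule Least_le) blast

lemma components_attained: obtains T where "spans V H T" "card T = components V H"
proof -
  have "spans V H V" unfolding spans_def using reach_refl by fast
  then have ex: "\<exists>j T. spans V H T \<and> card T = j" by blast
  have "\<exists>T. spans V H T \<and> card T = components V H"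
    unfolding components_def by (rule LeastI_ex[OF ex])
  then show thesis using that by blast
qed

context edge_moves
begin

lemma reach_subset_moved:
  assumes "(v, w) \<in> reach {} H'"
  shows "reach {} H \<subseteq> reach {} H'"
proof
  fix z assume z: "z \<in> reach {} H"
  obtain x y where xy: "z = (x, y)" by (cases z)
  have ab: "(a, b) \<in> reach {} H'" if "a \<in> {v, w}" "b \<in> {v, w}" for a b
    using that assms reach_sym[OF assms] by auto
  show "z \<in> reach {} H'"
    using reach_moved[of x y] z xy ab by (blast intro: reach_trans)
qed

text \<open>If \<open>v\<close> and \<open>w\<close> are joined afterwards, no connection is lost.
  If not, they were not joined before either and have different representatives; replacing these two
  by \<open>v\<close> and \<open>w\<close> gives a set that still meets all components.\<close>

lemma components_moved_le:
  assumes "finite V" "v \<in> V" "w \<in> V" and "(v, w) \<in> reach {} H \<longrightarrow> (v, w) \<in> reach {} H'"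
  shows "components V H' \<le> components V H"
proof -
  obtain T where T: "spans V H T" "card T = components V H" by (rule components_attained)
  have finT: "finite T" using T(1) assms(1) finite_subset by (auto simp: spans_def)
  show ?thesis
  proof (cases "(v, w) \<in> reach {} H'")
    case True
    then have "spans V H' T" using T(1) reach_subset_moved unfolding spans_def by blast
    then show ?thesis using components_le T(2) by metis
  next
    case False
    then have vw: "(v, w) \<notin> reach {} H" using assms(4) by blast
    obtain tv tw where t: "tv \<in> T" "tw \<in> T" "(tv, v) \<in> reach {} H" "(tw, w) \<in> reach {} H"
      using T(1) assms(2,3) unfolding spans_def by meson
    have "tv \<noteq> tw" using t vw reach_sym reach_trans by metis
    define T' where "T' = (T - {tv, tw}) \<union> {v, w}"
    have "card T' \<le> card (T - {tv, tw}) + card {v, w}" unfolding T'_def by (rule card_Un_le)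
    also have "card {v, w} \<le> card {tv, tw}" using \<open>tv \<noteq> tw\<close> by (simp add: card_insert_if)
    also have "card (T - {tv, tw}) + card {tv, tw} = card T"
      using t finT card_Diff_subset[of "{tv, tw}" T] card_mono[of T "{tv, tw}"] by simp
    finally have "card T' \<le> card T" by simp
    have fromvw: "\<exists>b\<in>{v, w}. (b, x) \<in> reach {} H'" if "(c, x) \<in> reach {} H" "c \<in> {v, w}" for c x
      using reach_moved[OF that(1)] that(2) by blast
    have "spans V H' T'"
      unfolding spans_def
    proof (intro conjI ballI)
      show "T' \<subseteq> V" using T(1) assms(2,3) by (auto simp: spans_def T'_def)
      fix x assume "x \<in> V"
      then obtain t' where t': "t' \<in> T" "(t', x) \<in> reach {} H" using T(1) unfolding spans_def by meson
      have "(v, x) \<in> reach {} H" if "t' = tv" using t' t(3) that by (blast intro: reach_trans reach_sym)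
      moreover have "(w, x) \<in> reach {} H" if "t' = tw" using t' t(4) that by (blast intro: reach_trans reach_sym)
      moreover have "t' \<in> T'" if "t' \<noteq> tv" "t' \<noteq> tw" using t' that by (simp add: T'_def)
      moreover have "v \<in> T'" "w \<in> T'" by (auto simp: T'_def)
      ultimately show "\<exists>t\<in>T'. (t, x) \<in> reach {} H'"
        using fromvw[of v x] fromvw[of w x] reach_moved[OF t'(2)] by blast
    qed
    from components_le[OF this] show ?thesis using \<open>card T' \<le> card T\<close> T(2) by simp
  qed
qed

lemma components_moved_less:
  assumes "finite V" "v \<in> V" "w \<in> V" and "(v, w) \<notin> reach {} H" "(v, w) \<in> reach {} H'"
  shows "components V H' < components V H"
proof -
  obtain T where T: "spans V H T" "card T = components V H" by (rule components_attained)
  have finT: "finite T" using T(1) assms(1) finite_subset by (auto simp: spans_def)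
  obtain tv tw where t: "tv \<in> T" "tw \<in> T" "(tv, v) \<in> reach {} H" "(tw, w) \<in> reach {} H"
    using T(1) assms(2,3) unfolding spans_def by meson
  have "tv \<noteq> tw" using t assms(4) reach_sym reach_trans by metis
  have sub: "reach {} H \<subseteq> reach {} H'" by (rule reach_subset_moved[OF assms(5)])
  then have tt: "(tv, tw) \<in> reach {} H'"
    using t(3,4) assms(5) by (blast intro: reach_trans reach_sym)
  have "spans V H' (T - {tw})"
    unfolding spans_def
  proof (intro conjI ballI)
    show "T - {tw} \<subseteq> V" using T(1) by (auto simp: spans_def)
    fix x assume "x \<in> V"
    then obtain t' where t': "t' \<in> T" "(t', x) \<in> reach {} H'"
      using T(1) sub unfolding spans_def by blast
    show "\<exists>t\<in>T - {tw}. (t, x) \<in> reach {} H'"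
    proof (cases "t' = tw")
      case True
      then have "(tv, x) \<in> reach {} H'" using tt t'(2) reach_trans by metis
      then show ?thesis using t(1) \<open>tv \<noteq> tw\<close> by blast
    qed (use t' in blast)
  qed
  from components_le[OF this] have "components V H' \<le> card (T - {tw})" .
  also have "\<dots> < card T" using finT t(2) by (intro psubset_card_mono) auto
  finally show ?thesis using T(2) by simp
qed

end

text \<open>Among all recolourings with the prescribed degrees, one with the fewest components in
  total is connected: otherwise two vertices outside \<open>U\<close> in different components of one colour
  class can be re-split so that they become connected there, through a cycle at one of them,
  while no other colour class gains a component.\<close>

lemma connected_recolouring:
  fixes E :: "'a medge set" and col :: "'a medge \<Rightarrow> nat"
  assumes finV: "finite V" and finE: "finite E"
    and edges: "\<And>e. e \<in> E \<Longrightarrow> fst e \<subseteq> V \<and> card (fst e) = 3"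
    and closed: "\<And>v w x. v \<in> V - U \<Longrightarrow> w \<in> V - U \<Longrightarrow> x \<in> E \<Longrightarrow> swap_edge v w x \<in> E"
    and cols: "\<And>x. x \<in> E \<Longrightarrow> col x < k"
    and deg: "\<And>c y. c < k \<Longrightarrow> y \<in> V \<Longrightarrow> degree {x \<in> E. col x = c} y = s"
    and "s \<ge> 2"
    and inner: "\<And>c u. c < k \<Longrightarrow> u \<in> V \<Longrightarrow> u \<in> U \<Longrightarrow> degree {x \<in> E. fst x \<subseteq> U \<and> col x = c} u < s"
  obtains col' where "\<And>x. x \<in> E \<Longrightarrow> col' x < k" "\<And>x. x \<in> E \<Longrightarrow> fst x \<subseteq> U \<Longrightarrow> col' x = col x"
    "\<And>c y. c < k \<Longrightarrow> y \<in> V \<Longrightarrow> degree {x \<in> E. col' x = c} y = s"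
    "\<And>c. c < k \<Longrightarrow> hconnected V {x \<in> E. col' x = c}"
proof -
  define Q where "Q f \<longleftrightarrow> (\<forall>x\<in>E. f x < k) \<and> (\<forall>x\<in>E. fst x \<subseteq> U \<longrightarrow> f x = col x) \<and>
    (\<forall>c<k. \<forall>y\<in>V. degree {x \<in> E. f x = c} y = s)" for f :: "'a medge \<Rightarrow> nat"
  define \<Psi> where "\<Psi> f = (\<Sum>c<k. components V {x \<in> E. f x = c})" for f :: "'a medge \<Rightarrow> nat"
  have "Q col" using cols deg by (simp add: Q_def)
  from ex_has_least_nat[of Q, OF this, of \<Psi>] obtain f where
    Qf: "Q f" and least: "\<And>g. Q g \<Longrightarrow> \<Psi> f \<le> \<Psi> g" by blast
  have f: "\<And>x. x \<in> E \<Longrightarrow> f x < k" "\<And>x. x \<in> E \<Longrightarrow> fst x \<subseteq> U \<Longrightarrow> f x = col x"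
    "\<And>c y. c < k \<Longrightarrow> y \<in> V \<Longrightarrow> degree {x \<in> E. f x = c} y = s"
    using Qf unfolding Q_def by blast+
  have "hconnected V {x \<in> E. f x = c0}" if c0: "c0 < k" for c0
  proof (rule ccontr)
    assume dis: "\<not> hconnected V {x \<in> E. f x = c0}"
    define H where "H c = {x \<in> E. f x = c}" for c
    have H: "e \<in> E" if "e \<in> H c" for e c using that by (simp add: H_def)
    have two: "\<exists>e1\<in>H c0. \<exists>e2\<in>H c0. e1 \<noteq> e2 \<and> y \<in> fst e1 \<and> y \<in> fst e2" if "y \<in> V" for y
    proof -
      have big: "\<not> card {x \<in> H c0. y \<in> fst x} \<le> Suc 0"
        using f(3)[OF c0 that] \<open>s \<ge> 2\<close> unfolding degree_def H_def by linarith
      have "finite {x \<in> H c0. y \<in> fst x}" using finE by (simp add: H_def)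
      with big obtain e1 e2 where
        "e1 \<in> {x \<in> H c0. y \<in> fst x}" "e2 \<in> {x \<in> H c0. y \<in> fst x}" "e1 \<noteq> e2"
        by (auto simp only: card_le_Suc0_iff_eq Ball_def)
      then show ?thesis by (intro bexI[of _ e1] bexI[of _ e2]) auto
    qed
    have out: "\<exists>e\<in>H c0. u \<in> fst e \<and> \<not> fst e \<subseteq> U" if "u \<in> V" "u \<in> U" for u
    proof (rule ccontr)
      assume n: "\<not> (\<exists>e\<in>H c0. u \<in> fst e \<and> \<not> fst e \<subseteq> U)"
      have "{x \<in> E. f x = c0 \<and> u \<in> fst x} \<subseteq> {x \<in> E. (fst x \<subseteq> U \<and> col x = c0) \<and> u \<in> fst x}"
      proof
        fix x assume "x \<in> {x \<in> E. f x = c0 \<and> u \<in> fst x}"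
        then have x: "x \<in> E" "f x = c0" "u \<in> fst x" by auto
        then have "fst x \<subseteq> U" using n unfolding H_def by blast
        then show "x \<in> {x \<in> E. (fst x \<subseteq> U \<and> col x = c0) \<and> u \<in> fst x}" using x f(2)[of x] by simp
      qed
      then have "degree {x \<in> E. f x = c0} u \<le> degree {x \<in> E. fst x \<subseteq> U \<and> col x = c0} u"
        unfolding degree_def mem_Collect_eq conj_assoc
        by (intro card_mono) (use finE in \<open>simp_all add: conj_assoc\<close>)
      then show False using f(3)[OF c0 that(1)] inner[OF c0 that] by simp
    qed
    \<comment> \<open>Every component meets V - U. Hence both vertices of the re-split can be chosen
      there, and edges inside \<open>U\<close> keep their colours.\<close>
    have esc: "\<exists>v\<in>V - U. (y, v) \<in> reach {} (H c0)" if yV: "y \<in> V" for y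
    proof (cases "y \<in> U")
      case True
      then obtain e where e: "e \<in> H c0" "y \<in> fst e" "\<not> fst e \<subseteq> U" using out yV by blast
      then obtain v where v: "v \<in> fst e" "v \<notin> U" by blast
      then have "(y, v) \<in> reach {} (H c0)" using e by (intro reach_edge[of e]) auto
      moreover have "v \<in> V" using v e edges[OF H[OF e(1)]] by blast
      ultimately show ?thesis using v by blast
    next
      case False
      then show ?thesis using yV by (intro bexI[of _ y]) simp_all
    qed
    obtain y1 y2 where y12: "y1 \<in> V" "y2 \<in> V" "(y1, y2) \<notin> reach {} (H c0)"
      using dis unfolding hconnected_iff_reach H_def by blast
    obtain v0 where v0: "v0 \<in> V - U" "(y1, v0) \<in> reach {} (H c0)" using esc[OF y12(1)] by blast
    obtain w where w: "w \<in> V - U" "(y2, w) \<in> reach {} (H c0)" using esc[OF y12(2)] by blast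
    have "(v0, w) \<notin> reach {} (H c0)"
    proof
      assume "(v0, w) \<in> reach {} (H c0)"
      from reach_trans[OF reach_trans[OF v0(2) this] reach_sym[OF w(2)]] show False using y12(3) by simp
    qed
    note vw0 = v0(1) w(1) this
    have edgesH: "fst e \<subseteq> V \<and> card (fst e) = 3" if "e \<in> H c0" for e using edges H[OF that] by blast
    \<comment> \<open>The vertex \<open>v\<close> is in the component of \<open>v0\<close>, hence
      not in that of \<open>w\<close>, and the connection of \<open>e1\<close> with
      \<open>e2\<close> off \<open>v\<close> avoids \<open>w\<close> as well. Sending the two edges
      to different vertices therefore merges the two components.\<close>
    obtain v e1 e2 a1 a2 where v: "v \<in> V - U" "(v0, v) \<in> reach {} (H c0)"
      and e: "e1 \<in> H c0" "e2 \<in> H c0" "e1 \<noteq> e2" "v \<in> fst e1" "v \<in> fst e2"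
      and a: "a1 \<in> fst e1 - {v}" "a2 \<in> fst e2 - {v}" "(a1, a2) \<in> reach {v} (H c0)"
      by (rule two_edges_on_a_cycle[OF finV edgesH two out vw0(1)])
    have vw: "(v, w) \<notin> reach {} (H c0)" using reach_trans[OF v(2), of w] vw0(3) by blast
    then have "v \<noteq> w" by auto
    have va: "(v, a1) \<in> reach {} (H c0)" using e a by (intro reach_edge[of e1]) auto
    have w_far: "z \<notin> {w}" if "(a1, z) \<in> reach {v} (H c0)" for z
      using subsetD[OF reach_mono[of "{}" "{v}" "H c0"] that] vw reach_trans[OF va, of z] by auto
    have "(a1, a2) \<in> reach ({v} \<union> {w}) (H c0)" by (rule reach_avoid_more[OF a(3) w_far])
    then have "(a1, a2) \<in> reach {v, w} (H c0)" by (simp add: insert_commute)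
    moreover have "a1 \<noteq> w" "a2 \<noteq> w" using w_far[of a1] w_far[OF a(3)] by auto
    moreover have "w \<notin> fst e1" "w \<notin> fst e2"
      using vw e reach_edge[of e1 "H c0" v "{}" w] reach_edge[of e2 "H c0" v "{}" w] by auto
    ultimately have link0: "linked v w (H c0) e1 e2"
      unfolding linked_def using e a by blast
    \<comment> \<open>All colours with a linked pair are included, not only \<open>c0\<close>: the
      same re-split joins \<open>v\<close> and \<open>w\<close> in each of them. In any other colour
      a connection of \<open>v\<close> and \<open>w\<close> comes with an edge through both, which
      is fixed.\<close>
    define K where "K = {c. \<exists>p p'. linked v w (H c) p p'}"
    have "\<forall>c\<in>K. \<exists>p p'. linked v w (H c) p p'" by (simp add: K_def)
    then obtain p p' where "\<forall>c\<in>K. linked v w (H c) (p c) (p' c)" by metis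
    then have pp: "linked v w (H c) (p c) (p' c)" if "c \<in> K" for c using that by blast
    have "c0 \<in> K" using link0 unfolding K_def by blast
    obtain \<phi> where phi: "\<And>x. x \<in> E \<Longrightarrow> \<phi> x \<in> E" "\<And>x. x \<in> E \<Longrightarrow> \<phi> (\<phi> x) = x"
      "\<And>x. \<phi> x = x \<or> \<phi> x = swap_edge v w x"
      "\<And>x. (v \<in> fst x) = (w \<in> fst x) \<Longrightarrow> \<phi> x = x"
      "\<And>c. c \<in> K \<Longrightarrow> (v \<in> fst (\<phi> (p c))) \<noteq> (v \<in> fst (\<phi> (p' c)))"
      "\<And>c y. y \<noteq> v \<Longrightarrow> y \<noteq> w \<Longrightarrow>
        degree {x \<in> E. f (\<phi> x) = c} y = degree {x \<in> E. f x = c} y"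
      "\<And>c. degree {x \<in> E. f (\<phi> x) = c} v + degree {x \<in> E. f (\<phi> x) = c} w =
        degree {x \<in> E. f x = c} v + degree {x \<in> E. f x = c} w"
      "\<And>c. \<bar>int (degree {x \<in> E. f (\<phi> x) = c} v) - int (degree {x \<in> E. f (\<phi> x) = c} w)\<bar> \<le> 1"
    proof -
      show thesis
      proof (rule resplit_colouring[OF finE \<open>v \<noteq> w\<close> closed[OF v(1) vw0(2)], where K = K
            and col = f and p = p and p' = p'], assumption, goal_cases)
        case (1 c)
        then show ?case using pp[OF 1] by (simp add: linked_def H_def)
      next
        case (2 \<phi>)
        show ?case by (rule that[OF 2])
      qed
    qed
    define H' where "H' c = {x \<in> E. f (\<phi> x) = c}" for c
    have moves: "edge_moves v w (H c) (H' c) \<phi>" for c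
      by unfold_locales
        (use phi(3) colour_class_permute[OF phi(1,2), of f c] in \<open>auto simp: H_def H'_def\<close>)
    have vV: "v \<in> V" "w \<in> V" using v(1) vw0(2) by auto
    have kept: "(v, w) \<in> reach {} (H' c)" if "c \<in> K" for c
      using edge_moves.reach_pair_moved[OF moves pp[OF that] phi(5)[OF that]] .
    have "(v, w) \<in> reach {} (H' c)" if r: "(v, w) \<in> reach {} (H c)" for c
    proof (cases "c \<in> K")
      case False
      then obtain e where "e \<in> H c" "v \<in> fst e" "w \<in> fst e"
        using common_edge_or_linked_if_reach[OF r \<open>v \<noteq> w\<close>] unfolding K_def by blast
      moreover from this have "e \<in> H' c" using phi(4)[of e] by (simp add: H_def H'_def)
      ultimately show ?thesis by (intro reach_edge[of e]) auto
    qed (rule kept)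
    then have le: "components V (H' c) \<le> components V (H c)" for c
      using edge_moves.components_moved_le[OF moves finV vV] by blast
    have less: "components V (H' c0) < components V (H c0)"
      using edge_moves.components_moved_less[OF moves finV vV vw kept[OF \<open>c0 \<in> K\<close>]] .
    have "\<Psi> (f \<circ> \<phi>) < \<Psi> f"
      unfolding \<Psi>_def
    proof (rule sum_strict_mono_ex1)
      show "\<forall>c\<in>{..<k}. components V {x \<in> E. (f \<circ> \<phi>) x = c} \<le> components V {x \<in> E. f x = c}"
        using le by (simp add: H_def H'_def)
      show "\<exists>c\<in>{..<k}. components V {x \<in> E. (f \<circ> \<phi>) x = c} < components V {x \<in> E. f x = c}"
        using less c0 by (auto simp: H_def H'_def)
    qed simp
    moreover have "Q (f \<circ> \<phi>)"
      unfolding Q_def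
    proof (intro conjI ballI allI impI)
      show "(f \<circ> \<phi>) x < k" if "x \<in> E" for x using f(1) phi(1)[OF that] by simp
      show "(f \<circ> \<phi>) x = col x" if "x \<in> E" "fst x \<subseteq> U" for x
      proof -
        have "\<phi> x = x" using phi(4)[of x] that(2) v(1) vw0(2) by blast
        then show ?thesis using f(2) that by simp
      qed
      show "degree {x \<in> E. (f \<circ> \<phi>) x = c} y = s" if "c < k" "y \<in> V" for c y
      proof -
        have "degree {x \<in> E. f (\<phi> x) = c} y = s"
        proof (cases "y = v \<or> y = w")
          case False
          then show ?thesis using phi(6)[of y c] f(3)[OF that] by simp
        next
          case True
          \<comment> \<open>The two degrees add up to the even number 2 s, so a difference of at
            most 1 is 0 and the classes stay regular.\<close>
          have half: "a = s \<and> b = s" if "a + b = s + s" "\<bar>int a - int b\<bar> \<le> 1" for a b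
          proof -
            have "a \<noteq> Suc b" "b \<noteq> Suc a" using that(1) by presburger+
            then show ?thesis using that by linarith
          qed
          from half[OF _ phi(8)[of c]] show ?thesis
            using phi(7)[of c] f(3)[OF \<open>c < k\<close> vV(1)] f(3)[OF \<open>c < k\<close> vV(2)] True by metis
        qed
        then show ?thesis by simp
      qed
    qed
    ultimately show False using least by (meson linorder_not_le)
  qed
  then show thesis using that f by blast
qed

section \<open>Counting\<close>

lemma card_subsets_meeting:
  assumes "finite V" "U \<subseteq> V" "j \<le> h"
  shows "card {e. e \<subseteq> V \<and> card e = h \<and> card (e \<inter> U) = j} =
    (card U choose j) * ((card V - card U) choose (h - j))"
proof -
  let ?A = "{a. a \<subseteq> U \<and> card a = j}" and ?B = "{b. b \<subseteq> V - U \<and> card b = h - j}"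
  have fU: "finite U" using assms finite_subset by blast
  have "bij_betw (\<lambda>(a, b). a \<union> b) (?A \<times> ?B) {e. e \<subseteq> V \<and> card e = h \<and> card (e \<inter> U) = j}"
  proof (rule bij_betwI[where g = "\<lambda>e. (e \<inter> U, e - U)"])
    show "(\<lambda>(a, b). a \<union> b) \<in> ?A \<times> ?B \<rightarrow> {e. e \<subseteq> V \<and> card e = h \<and> card (e \<inter> U) = j}"
    proof
      fix z assume "z \<in> ?A \<times> ?B"
      then obtain a b where z: "z = (a, b)" "a \<subseteq> U" "card a = j" "b \<subseteq> V - U" "card b = h - j" by auto
      have "finite a" "finite b" "a \<inter> b = {}" using z fU assms(1) finite_subset by blast+
      then have "card (a \<union> b) = h" using z assms(3) by (simp add: card_Un_disjoint)
      moreover have "(a \<union> b) \<inter> U = a" using z by blast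
      ultimately show "(\<lambda>(a, b). a \<union> b) z \<in> {e. e \<subseteq> V \<and> card e = h \<and> card (e \<inter> U) = j}"
        using z assms(2) by auto
    qed
    show "(\<lambda>e. (e \<inter> U, e - U)) \<in> {e. e \<subseteq> V \<and> card e = h \<and> card (e \<inter> U) = j} \<rightarrow> ?A \<times> ?B"
    proof
      fix e assume "e \<in> {e. e \<subseteq> V \<and> card e = h \<and> card (e \<inter> U) = j}"
      then have e: "e \<subseteq> V" "card e = h" "card (e \<inter> U) = j" by auto
      then have "card (e - U) = h - j"
        using card_Diff_subset_Int[of e U] fU by (simp add: finite_Int)
      then show "(e \<inter> U, e - U) \<in> ?A \<times> ?B" using e by auto
    qed
  qed auto
  from bij_betw_same_card[OF this]
  have "card {e. e \<subseteq> V \<and> card e = h \<and> card (e \<inter> U) = j} = card ?A * card ?B"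
    by (simp add: card_cartesian_product)
  also have "card ?B = (card V - card U) choose (h - j)"
    using n_subsets[of "V - U" "h - j"] assms fU by (simp add: card_Diff_subset)
  finally show ?thesis using n_subsets[OF fU, of j] by simp
qed

lemma finite_complete_edges: "finite V \<Longrightarrow> finite (complete_edges lam h V)"
  unfolding complete_edges_def by (intro finite_cartesian_product finite_subset[OF _ finite_Pow_iff[THEN iffD2]]) auto

lemma card_complete_edges_meeting:
  assumes "finite V" "U \<subseteq> V" "j \<le> h"
  shows "card {x \<in> complete_edges lam h V. card (fst x \<inter> U) = j} =
    lam * ((card U choose j) * ((card V - card U) choose (h - j)))"
proof -
  have "{x \<in> complete_edges lam h V. card (fst x \<inter> U) = j} =
      {e. e \<subseteq> V \<and> card e = h \<and> card (e \<inter> U) = j} \<times> {..<lam}"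
    by (auto simp: complete_edges_def)
  then show ?thesis using card_subsets_meeting[OF assms] by (simp add: card_cartesian_product)
qed

lemma degree_complete_edges:
  assumes "finite V" "v \<in> V" "h > 0"
  shows "degree (complete_edges lam h V) v = lam * ((card V - 1) choose (h - 1))"
proof -
  have "{x \<in> complete_edges lam h V. v \<in> fst x} =
      {x \<in> complete_edges lam h V. card (fst x \<inter> {v}) = 1}" by (auto simp: Int_insert_right)
  then show ?thesis
    using card_complete_edges_meeting[of V "{v}" 1 h lam] assms by (simp add: degree_def)
qed

lemma sum_degree:
  assumes "finite H" "finite S"
  shows "(\<Sum>y\<in>S. degree H y) = (\<Sum>x\<in>H. card (fst x \<inter> S))"
proof -
  have "degree H y = (\<Sum>x\<in>H. if y \<in> fst x then 1 else 0)" for y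
    using assms(1) by (simp add: degree_def sum.If_cases Int_def)
  moreover have "card (fst x \<inter> S) = (\<Sum>y\<in>S. if y \<in> fst x then 1 else 0)" for x :: "'a medge"
    using assms(2) by (simp add: sum.If_cases Int_def conj_commute)
  ultimately show ?thesis using sum.swap by simp
qed

lemma degree_partition:
  assumes "partition_on E G" "finite E"
  shows "degree E v = (\<Sum>H\<in>G. degree H v)"
proof -
  have E: "E = \<Union>G" "disjoint G" using assms(1) by (auto simp: partition_on_def)
  have fin: "finite H" if "H \<in> G" for H using that E assms(2) by (meson Union_upper finite_subset)
  have "finite G" using E(1) assms(2) by (metis finite_UnionD)
  have "{x \<in> E. v \<in> fst x} = (\<Union>H\<in>G. {x \<in> H. v \<in> fst x})" using E by blast
  moreover have "card (\<Union>H\<in>G. {x \<in> H. v \<in> fst x}) = (\<Sum>H\<in>G. card {x \<in> H. v \<in> fst x})"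
  proof (rule card_UN_disjoint[OF \<open>finite G\<close>])
    show "\<forall>H\<in>G. \<forall>H'\<in>G. H \<noteq> H' \<longrightarrow> {x \<in> H. v \<in> fst x} \<inter> {x \<in> H'. v \<in> fst x} = {}"
      using E(2) unfolding disjoint_def by blast
  qed (use fin in auto)
  ultimately show ?thesis by (simp add: degree_def)
qed

lemma degree_Un_disjoint:
  assumes "finite A" "finite B" "A \<inter> B = {}"
  shows "degree (A \<union> B) v = degree A v + degree B v"
proof -
  have "{x \<in> A \<union> B. v \<in> fst x} = {x \<in> A. v \<in> fst x} \<union> {x \<in> B. v \<in> fst x}" by blast
  moreover have "{x \<in> A. v \<in> fst x} \<inter> {x \<in> B. v \<in> fst x} = {}" using assms(3) by blast
  ultimately show ?thesis using assms by (simp add: degree_def card_Un_disjoint)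
qed

lemma card_factorization:
  assumes "is_factorization s V (complete_edges lam h V) G" "finite V" "V \<noteq> {}" "h > 0"
  shows "card G * s = lam * ((card V - 1) choose (h - 1))"
proof -
  obtain v where v: "v \<in> V" using assms(3) by blast
  have "lam * ((card V - 1) choose (h - 1)) = (\<Sum>H\<in>G. degree H v)"
    using degree_complete_edges[OF assms(2) v assms(4), of lam] assms(1)
      degree_partition[OF _ finite_complete_edges[OF assms(2)], of lam h G v]
    by (simp add: is_factorization_def)
  also have "\<dots> = (\<Sum>H\<in>G. s)"
    using assms(1) v by (intro sum.cong) (auto simp: is_factorization_def is_factor_def)
  finally show ?thesis by simp
qed

lemma card_factor:
  assumes "is_factor s V (complete_edges lam h V) H" "finite V"
  shows "h * card H = s * card V"
proof -
  have sub: "H \<subseteq> complete_edges lam h V" and d: "\<And>v. v \<in> V \<Longrightarrow> degree H v = s"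
    using assms(1) by (auto simp: is_factor_def)
  have "finite H" using sub finite_complete_edges[OF assms(2)] finite_subset by blast
  have "s * card V = (\<Sum>y\<in>V. degree H y)" using d by simp
  also have "\<dots> = (\<Sum>x\<in>H. card (fst x \<inter> V))" by (rule sum_degree[OF \<open>finite H\<close> assms(2)])
  also have "\<dots> = (\<Sum>x\<in>H. h)"
    using sub by (intro sum.cong) (auto simp: complete_edges_def Int_absorb2)
  finally show ?thesis by simp
qed

lemma complete_edges_nonempty:
  assumes "finite V" "h \<le> card V" "lam > 0"
  shows "complete_edges lam h V \<noteq> {}"
proof -
  obtain e where "e \<subseteq> V" "card e = h" using obtain_subset_with_card_n[OF assms(2)] by metis
  then have "(e, 0) \<in> complete_edges lam h V" using assms(3) by (simp add: complete_edges_def)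
  then show ?thesis by blast
qed

lemma admissible_if_factorization:
  assumes "is_factorization s V (complete_edges lam h V) G" "finite V" "h \<le> card V" "h > 0" "lam > 0"
  shows "admissible h (card V) s lam"
proof -
  have "V \<noteq> {}" using assms(3,4) by auto
  have "h dvd s * card V"
  proof -
    have "\<Union>G \<noteq> {}" using complete_edges_nonempty[OF assms(2,3,5)] assms(1)
      by (simp add: is_factorization_def partition_on_def)
    then obtain H where "H \<in> G" by blast
    then have "is_factor s V (complete_edges lam h V) H" using assms(1) by (simp add: is_factorization_def)
    from card_factor[OF this assms(2)] show ?thesis by (metis dvd_triv_left)
  qed
  moreover have "s dvd lam * ((card V - 1) choose (h - 1))"
    using card_factorization[OF assms(1,2) \<open>V \<noteq> {}\<close> assms(4)] by (metis dvd_triv_right)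
  ultimately show ?thesis by (simp add: admissible_def)
qed

section \<open>Distributing the edges outside \<open>U\<close> over the colours\<close>

lemma colouring_with_sizes:
  fixes k :: nat
  assumes "finite A" "card A = (\<Sum>c<k. a c)"
  shows "\<exists>f. (\<forall>x\<in>A. f x < k) \<and> (\<forall>c<k. card {x \<in> A. f x = c} = a c)"
  using assms
proof (induction k arbitrary: A)
  case 0
  then show ?case by simp
next
  case (Suc k)
  obtain B where B: "B \<subseteq> A" "card B = a k"
    using obtain_subset_with_card_n[of "a k" A] Suc.prems by auto
  have finB: "finite B" using B Suc.prems finite_subset by blast
  have "card (A - B) = (\<Sum>c<k. a c)" using B finB Suc.prems by (simp add: card_Diff_subset)
  from Suc.IH[OF _ this] obtain f where
    f: "\<forall>x\<in>A - B. f x < k" "\<forall>c<k. card {x \<in> A - B. f x = c} = a c" using Suc.prems by blast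
  define g where "g x = (if x \<in> B then k else f x)" for x
  have "g x < Suc k" if "x \<in> A" for x using f(1) that by (auto simp: g_def less_Suc_eq)
  moreover have "card {x \<in> A. g x = c} = a c" if "c < Suc k" for c
  proof (cases "c = k")
    case True
    have "{x \<in> A. g x = c} = B" using f(1) B True by (auto simp: g_def)
    then show ?thesis using B True by simp
  next
    case False
    then have "{x \<in> A. g x = c} = {x \<in> A - B. f x = c}" by (auto simp: g_def)
    then show ?thesis using f(2) that False by simp
  qed
  ultimately show ?case by blast
qed

lemma sum_between:
  fixes l u :: "nat \<Rightarrow> int"
  assumes "\<And>c. c < k \<Longrightarrow> l c \<le> u c" "(\<Sum>c<k. l c) \<le> A" "A \<le> (\<Sum>c<k. u c)"
  shows "\<exists>a. (\<forall>c<k. l c \<le> a c \<and> a c \<le> u c) \<and> (\<Sum>c<k. a c) = A"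
  using assms
proof (induction k arbitrary: A)
  case 0
  then show ?case by simp
next
  case (Suc k)
  \<comment> \<open>The least admissible last term for which the other terms, at their upper bounds,
    still make up the rest of \<open>A\<close>.\<close>
  define b where "b = max (l k) (A - (\<Sum>c<k. u c))"
  have lu: "l k \<le> u k" "(\<Sum>c<k. l c) \<le> (\<Sum>c<k. u c)"
    using Suc.prems(1) by (auto intro: sum_mono)
  have b: "l k \<le> b" "b \<le> u k" using lu Suc.prems(3) by (auto simp: b_def)
  have "(\<Sum>c<k. l c) \<le> A - b" "A - b \<le> (\<Sum>c<k. u c)"
    using lu Suc.prems(2) by (auto simp: b_def)
  with Suc.IH Suc.prems(1) obtain a where
    a: "\<forall>c<k. l c \<le> a c \<and> a c \<le> u c" "(\<Sum>c<k. a c) = A - b" by (metis less_SucI)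
  have "(\<Sum>c<Suc k. (a(k := b)) c) = A" using a(2) by simp
  moreover have "\<forall>c<Suc k. l c \<le> (a(k := b)) c \<and> (a(k := b)) c \<le> u c"
    using a(1) b by (auto simp: less_Suc_eq)
  ultimately show ?case by blast
qed

text \<open>For a colour whose edges outside \<open>U\<close> number \<open>T\<close> and have degree sum \<open>D\<close> over \<open>U\<close>,
  the number \<open>a\<close> of those with two vertices in \<open>U\<close> determines the numbers \<open>D - 2a\<close> and
  \<open>T - D + a\<close> of those with one and with none, so \<open>a\<close> ranges over
  \<open>{max 0 (D - T)..D div 2}\<close>. Index 0 stands for the \<open>q\<close> old colours, index 1 for the others.\<close>

lemma type_bounds:
  fixes m t r s lam k q T0 T1 D0 D1 A0 A1 A2 :: int
  assumes m: "m \<ge> 4" and t: "t \<ge> 1" and r: "r \<ge> 1" and sr: "s > r" and lam: "lam \<ge> 1"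
    and q: "0 \<le> q" "q \<le> k"
    and hq: "2 * (q * r) = lam * ((m - 1) * (m - 2))"
    and hk: "2 * (k * s) = lam * ((m + t - 1) * (m + t - 2))"
    and T0: "3 * T0 = s * (m + t) - r * m" and T1: "3 * T1 = s * (m + t)"
    and D0: "D0 = (s - r) * m" and D1: "D1 = s * m"
    and A2: "2 * A2 = lam * (t * (m * (m - 1)))" and A1: "2 * A1 = lam * (m * (t * (t - 1)))"
    and A0: "6 * A0 = lam * (t * (t - 1) * (t - 2))"
    and iii: "q < k \<Longrightarrow> m \<le> 2 * t"
    and iv: "(k - q) * s * (2 * m - t) \<le> 3 * A2"
  shows "max 0 (D0 - T0) \<le> D0 div 2"
    and "q < k \<Longrightarrow> max 0 (D1 - T1) \<le> D1 div 2"
    and "q * max 0 (D0 - T0) + (k - q) * max 0 (D1 - T1) \<le> A2"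
    and "A2 \<le> q * (D0 div 2) + (k - q) * (D1 div 2)"
    and "q * D0 + (k - q) * D1 = A1 + 2 * A2"
    and "q * T0 + (k - q) * T1 = A0 + A1 + A2"
proof -
  have s: "s \<ge> 2" using r sr by simp
  have qpos: "q > 0"
  proof (rule ccontr)
    assume "\<not> q > 0"
    then have "q = 0" using q by simp
    moreover have "lam * ((m - 1) * (m - 2)) > 0" using m lam by (intro mult_pos_pos) auto
    ultimately show False using hq by (metis mult_zero_left mult_zero_right less_irrefl)
  qed
  have "2 * (q * D0 + (k - q) * D1) = m * (2 * (k * s) - 2 * (q * r))"
    unfolding D0 D1 by algebra
  also have "\<dots> = 2 * A1 + 2 * (2 * A2)" unfolding hk hq A1 A2 by algebra
  finally show sumD: "q * D0 + (k - q) * D1 = A1 + 2 * A2" by simp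
  have "6 * (q * T0 + (k - q) * T1) = 2 * (q * (3 * T0) + (k - q) * (3 * T1))" by simp
  also have "\<dots> = (m + t) * (2 * (k * s)) - m * (2 * (q * r))" unfolding T0 T1 by algebra
  also have "\<dots> = 6 * A0 + 3 * (2 * A1) + 3 * (2 * A2)" unfolding hk hq A1 A2 A0 by algebra
  finally show sumT: "q * T0 + (k - q) * T1 = A0 + A1 + A2" by simp
  have "0 \<le> m * (t * (t - 1))" using m t by simp
  then have "0 \<le> lam * (m * (t * (t - 1)))" using lam m t by simp
  then have A1n: "A1 \<ge> 0" using A1 by simp
  have A2n: "A2 \<ge> 0"
  proof -
    have "0 \<le> lam * (t * (m * (m - 1)))" using m t lam by simp
    then show ?thesis using A2 by simp
  qed
  have A0n: "A0 \<ge> 0"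
  proof -
    have "0 \<le> t * (t - 1) * (t - 2)" using t by (cases "t = 1") auto
    then have "0 \<le> lam * (t * (t - 1) * (t - 2))" using lam by simp
    then show ?thesis using A0 by simp
  qed
  have D0n: "D0 \<ge> 0" "D1 \<ge> 0" using D0 D1 m sr s by auto
  have low: "max 0 (D - T) \<le> D div 2" if "D \<ge> 0" "D \<le> 2 * T" for D T :: int
    using that by linarith
  \<comment> \<open>The range is nonempty iff D \<le> 2 T, that is, iff two vertices in
    \<open>U\<close> per edge suffice. For a new colour this is 3 m \<le> 2 (m + t), which is
    (iii).\<close>
  show "max 0 (D1 - T1) \<le> D1 div 2" if "q < k"
  proof (rule low[OF D0n(2)])
    have "s * (3 * m) \<le> s * (2 * (m + t))" using iii[OF that] s by (intro mult_left_mono) auto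
    then have "3 * D1 \<le> 3 * (2 * T1)" using T1 unfolding D1 by (simp add: algebra_simps)
    then show "D1 \<le> 2 * T1" by simp
  qed
  show "max 0 (D0 - T0) \<le> D0 div 2"
  proof (rule low[OF D0n(1)])
    show "D0 \<le> 2 * T0"
    proof (cases "q = k")
      \<comment> \<open>Condition (iii) says nothing when there are no new colours. But then all
        colours have the same D and T, and summing over them gives the inequality.\<close>
      case True
      then have "q * D0 \<le> q * (2 * T0)" using sumD sumT A0n A1n by simp
      then show ?thesis using qpos by simp
    next
      case False
      then have "s * (3 * m) \<le> s * (2 * (m + t))" using iii q s by (intro mult_left_mono) auto
      moreover have "0 \<le> r * m" using r m by simp
      ultimately have "3 * D0 \<le> 3 * (2 * T0)" using T0 unfolding D0 by (simp add: algebra_simps)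
      then show ?thesis by simp
    qed
  qed
  show "q * max 0 (D0 - T0) + (k - q) * max 0 (D1 - T1) \<le> A2"
  proof -
    have "3 * (D0 - T0) = 3 * (D1 - T1) - 2 * (r * m)"
      using T0 T1 unfolding D0 D1 by (simp add: algebra_simps)
    moreover have "0 \<le> r * m" using r m by simp
    ultimately have "3 * (D0 - T0) \<le> 3 * (D1 - T1)" by simp
    then have d01: "D0 - T0 \<le> D1 - T1" by simp
    \<comment> \<open>If both lower bounds are given by D - T, they sum to A2 - A0. If only the new
      colours have a positive one, the claim is exactly (iv), since 3 (D1 - T1) = s (2 m -
      t).\<close>
    consider "D0 - T0 \<ge> 0" | "D0 - T0 < 0" "D1 - T1 \<ge> 0" | "D1 - T1 < 0" by linarith
    then show ?thesis
    proof cases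
      case 1
      then have "q * max 0 (D0 - T0) + (k - q) * max 0 (D1 - T1) = q * (D0 - T0) + (k - q) * (D1 - T1)"
        using d01 by (simp add: max_def)
      also have "\<dots> = A2 - A0" using sumD sumT by (simp add: algebra_simps)
      finally show ?thesis using A0n by simp
    next
      case 2
      have "3 * ((k - q) * (D1 - T1)) = (k - q) * (3 * D1 - 3 * T1)" by simp
      also have "\<dots> = (k - q) * s * (2 * m - t)" unfolding T1 D1 by algebra
      also note iv
      finally have "(k - q) * (D1 - T1) \<le> A2" by linarith
      then show ?thesis using 2 by (simp add: max_def)
    next
      case 3
      then show ?thesis using A2n d01 by (simp add: max_def)
    qed
  qed
  show "A2 \<le> q * (D0 div 2) + (k - q) * (D1 div 2)"
  proof -
    \<comment> \<open>The values D sum to A1 + 2 A2, so the upper bound says that the total loss by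
      rounding is at most A1: each colour with odd D needs an edge with just one vertex in
      \<open>U\<close>.\<close>
    have odd: "q * (D0 mod 2) + (k - q) * (D1 mod 2) \<le> A1"
    proof (cases "q = k")
      case False
      then have mt: "m \<le> 2 * t" using iii q by simp
      show ?thesis
      proof (cases "even m")
        case True
        then have "D0 mod 2 = 0" "D1 mod 2 = 0" by (auto simp: D0 D1)
        then show ?thesis using A1n by simp
      next
        \<comment> \<open>For odd \<open>m\<close> it is enough that k \<le> A1. The factor 10 below
          is 2 * 5, from s \<ge> 2 and m \<ge> 5, and absorbs the constant 2 next to 9 t (t - 1)
          because t \<ge> 3.\<close>
        case odd: False
        then have m5: "m \<ge> 5" using m by presburger
        then have t3: "t \<ge> 3" using mt by simp
        have tt: "t * (t - 1) \<ge> 3 * 2" using t3 by (intro mult_mono) auto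
        have "(m + t - 1) * (m + t - 2) \<le> (3 * t - 1) * (3 * t - 2)"
          using mt m5 t3 by (intro mult_mono) auto
        also have "\<dots> = 9 * (t * (t - 1)) + 2" by algebra
        also have "\<dots> \<le> 10 * (t * (t - 1))" using tt by simp
        also have "\<dots> \<le> (s * m) * (t * (t - 1))"
        proof (rule mult_right_mono)
          have "2 * 5 \<le> s * m" using s m5 by (intro mult_mono) auto
          then show "10 \<le> s * m" by simp
        qed (use tt in simp)
        finally have "lam * ((m + t - 1) * (m + t - 2)) \<le> lam * ((s * m) * (t * (t - 1)))"
          using lam by (intro mult_left_mono) auto
        also have "\<dots> = s * (2 * A1)" unfolding A1 by algebra
        finally have "s * k \<le> s * A1" using hk by (simp add: algebra_simps)
        then have "k \<le> A1" using s by simp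
        moreover have "q * (D0 mod 2) \<le> q * 1" "(k - q) * (D1 mod 2) \<le> (k - q) * 1"
          using q by (intro mult_left_mono; simp)+
        ultimately show ?thesis by simp
      qed
    next
      case True
      show ?thesis
      proof (cases "even D0")
        case True
        then show ?thesis using \<open>q = k\<close> A1n by (simp add: even_iff_mod_2_eq_zero)
      next
        case odd: False
        have "(2 * q) * (s * ((m - 1) * (m - 2))) = (2 * (k * s)) * ((m - 1) * (m - 2))"
          unfolding True by algebra
        also have "\<dots> = (lam * ((m - 1) * (m - 2))) * ((m + t - 1) * (m + t - 2))"
          unfolding hk by algebra
        also have "\<dots> = (2 * q) * (r * ((m + t - 1) * (m + t - 2)))" unfolding hq[symmetric] by algebra
        finally have ratio: "s * ((m - 1) * (m - 2)) = r * ((m + t - 1) * (m + t - 2))"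
          using qpos by simp
        have "q \<le> A1"
        proof (cases "t = 1")
          \<comment> \<open>With a single new vertex A1 is 0, so no odd D can be afforded. Comparing
            the numbers of factors gives D0 = 2 s.\<close>
          case True
          have "(m - 1) * (s * (m - 2)) = (m - 1) * (r * m)"
            using ratio unfolding True by (simp add: algebra_simps)
          then have "s * (m - 2) = r * m" using m by simp
          then have "D0 = 2 * s" unfolding D0 by (simp add: algebra_simps)
          then show ?thesis using odd by simp
        next
          case False
          then have t2: "t \<ge> 2" using t by simp
          \<comment> \<open>The ratio shows that m - 1 divides the positive number r t (t - 1),
            which is therefore at least m - 1; that bounds A1 from below.\<close>
          have eq: "r * (t * (t - 1)) = (m - 1) * (s * (m - 2) - r * (m - 1) - r * (2 * t - 1))"
            using ratio by algebra
          have "0 < r * (t * (t - 1))" using r t2 by simp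
          then have "0 < s * (m - 2) - r * (m - 1) - r * (2 * t - 1)"
            unfolding eq using m by (simp add: zero_less_mult_iff)
          then have "(m - 1) * 1 \<le> (m - 1) * (s * (m - 2) - r * (m - 1) - r * (2 * t - 1))"
            using m by (intro mult_left_mono) auto
          then have ge: "m - 1 \<le> r * (t * (t - 1))" using eq by simp
          have "r * (2 * q) = lam * ((m - 2) * (m - 1))" using hq by (simp add: algebra_simps)
          also have "\<dots> \<le> lam * (m * (r * (t * (t - 1))))"
            using ge m lam by (intro mult_left_mono mult_mono) auto
          also have "\<dots> = r * (2 * A1)" unfolding A1 by algebra
          finally show ?thesis using r by simp
        qed
        then show ?thesis using True odd by (simp add: odd_iff_mod_2_eq_one)
      qed
    qed
    have half: "2 * (D div 2) = D - D mod 2" for D :: int by (simp add: minus_mod_eq_mult_div)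
    have "2 * (q * (D0 div 2) + (k - q) * (D1 div 2)) =
        (q * D0 + (k - q) * D1) - (q * (D0 mod 2) + (k - q) * (D1 mod 2))"
      using half[of D0] half[of D1] by algebra
    then show ?thesis using sumD odd by simp
  qed
qed

section \<open>Embedding\<close>

lemma swap_edge_complete_edges:
  assumes "x \<in> complete_edges lam h V" "v \<in> V" "w \<in> V"
  shows "swap_edge v w x \<in> complete_edges lam h V"
proof -
  have "transpose v w ` fst x \<subseteq> V"
    using assms by (auto simp: complete_edges_def transpose_def split: if_splits)
  moreover have "card (transpose v w ` fst x) = card (fst x)"
    by (rule card_image) simp
  ultimately show ?thesis using assms(1) by (auto simp: complete_edges_def swap_edge_def)
qed

lemma swap_edge_inside:
  assumes "v \<in> U \<longleftrightarrow> w \<in> U" "fst (swap_edge v w x) \<subseteq> U"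
  shows "fst x \<subseteq> U"
proof
  fix z assume "z \<in> fst x"
  then have "transpose v w z \<in> U" using assms(2) by (auto simp: swap_edge_def)
  then show "z \<in> U" using assms(1) by (auto simp: transpose_def split: if_splits)
qed

lemma sum_by_type:
  fixes \<tau> g :: "'b \<Rightarrow> nat"
  assumes "finite C" "\<And>x. x \<in> C \<Longrightarrow> \<tau> x \<le> 2 \<and> g x = h (\<tau> x)"
  shows "sum g C = h 0 * card {x \<in> C. \<tau> x = 0} + h 1 * card {x \<in> C. \<tau> x = 1} +
    h 2 * card {x \<in> C. \<tau> x = 2}"
proof -
  have "sum g C = (\<Sum>j\<in>{0, 1, 2}. sum g {x \<in> C. \<tau> x = j})"
  proof (rule sum.group[symmetric])
    show "\<tau> ` C \<subseteq> {0, 1, 2}"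
    proof
      fix j assume "j \<in> \<tau> ` C"
      then have "j \<le> 2" using assms(2) by blast
      then show "j \<in> {0, 1, 2}" by auto
    qed
  qed (use assms(1) in simp_all)
  also have "\<dots> = (\<Sum>j\<in>{0, 1, 2}. h j * card {x \<in> C. \<tau> x = j})"
  proof (rule sum.cong)
    fix j
    have "sum g {x \<in> C. \<tau> x = j} = (\<Sum>x\<in>{x \<in> C. \<tau> x = j}. h j)"
      using assms(2) by (intro sum.cong) auto
    then show "sum g {x \<in> C. \<tau> x = j} = h j * card {x \<in> C. \<tau> x = j}" by simp
  qed simp
  finally show ?thesis by simp
qed

lemma real_choose_two: "2 * real (n choose 2) = real n * (real n - 1)"
proof -
  have "2 * (n choose 2) = n * (n - 1)"
    unfolding choose_two by (rule dvd_mult_div_cancel) (cases n; simp)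
  then have "2 * real (n choose 2) = real (n * (n - 1))" by (metis of_nat_mult of_nat_numeral)
  then show ?thesis by (cases n) (auto simp: algebra_simps)
qed

lemma int_choose_two: "2 * int (n choose 2) = int n * (int n - 1)"
proof -
  have "real_of_int (2 * int (n choose 2)) = real_of_int (int n * (int n - 1))"
    using real_choose_two[of n] by simp
  then show ?thesis by (simp only: of_int_eq_iff)
qed

lemma int_choose_three: "6 * int (n choose 3) = int n * (int n - 1) * (int n - 2)"
proof (induction n)
  case (Suc n)
  have "Suc n choose 3 = (n choose 2) + (n choose 3)" by (simp add: numeral_3_eq_3 numeral_2_eq_2)
  then have "6 * int (Suc n choose 3) = 3 * (2 * int (n choose 2)) + 6 * int (n choose 3)" by simp
  then show ?case unfolding int_choose_two Suc.IH by (simp add: algebra_simps)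
qed simp

text \<open>Only the two degree sums of each colour, over \<open>U\<close> and over \<open>V - U\<close>, have to be arranged,
  by choosing how many edges meet \<open>U\<close> in two, one and no vertices; balancing does the rest.\<close>

lemma outer_colouring:
  fixes V U :: "'a set" and m n r s lam k q :: nat
  defines "O' \<equiv> complete_edges lam 3 V - complete_edges lam 3 U"
  assumes m: "m > 3" and n: "n > m" and r: "r > 0" and lam: "lam > 0" and sr: "r < s"
    and V: "finite V" "card V = n" "U \<subseteq> V" "card U = m"
    and qk: "q \<le> k" and q: "q * r = lam * ((m - 1) choose 2)" and k: "k * s = lam * ((n - 1) choose 2)"
    and dvd: "3 dvd r * m" "3 dvd s * n"
    and iii: "q < k \<Longrightarrow> 3 * m \<le> 2 * n"
    and iv: "(3 * int m - int n) * int ((k - q) * s) \<le> 3 * int (lam * ((n - m) * (m choose 2)))"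
  obtains col where "\<And>x. x \<in> O' \<Longrightarrow> col x < k"
    "\<And>c y. c < k \<Longrightarrow> y \<in> U \<Longrightarrow> degree {x \<in> O'. col x = c} y = (if c < q then s - r else s)"
    "\<And>c y. c < k \<Longrightarrow> y \<in> V - U \<Longrightarrow> degree {x \<in> O'. col x = c} y = s"
proof -
  have finO: "finite O'" unfolding O'_def using finite_complete_edges[OF V(1)] by blast
  have finU: "finite U" using V finite_subset by blast
  define \<tau> where "\<tau> x = card (fst x \<inter> U)" for x :: "'a medge"
  have O3: "fst x \<subseteq> V" "card (fst x) = 3" "finite (fst x)" "\<tau> x \<le> 2" if "x \<in> O'" for x
  proof -
    show 1: "fst x \<subseteq> V" "card (fst x) = 3" using that by (auto simp: O'_def complete_edges_def)
    show 2: "finite (fst x)" using 1(2) by (metis card.infinite zero_neq_numeral)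
    have "\<not> fst x \<subseteq> U" using that by (auto simp: O'_def complete_edges_def)
    then have "fst x \<inter> U \<subset> fst x" by blast
    then show "\<tau> x \<le> 2" using psubset_card_mono[OF 2, of "fst x \<inter> U"] 1(2) by (simp add: \<tau>_def)
  qed
  have cardO: "card {x \<in> O'. \<tau> x = j} = lam * ((m choose j) * ((n - m) choose (3 - j)))"
    if "j \<le> 2" for j
  proof -
    have "{x \<in> O'. \<tau> x = j} = {x \<in> complete_edges lam 3 V. card (fst x \<inter> U) = j}"
      using that by (auto simp: O'_def complete_edges_def \<tau>_def Int_absorb2)
    then show ?thesis using card_complete_edges_meeting[OF V(1,3), of j 3 lam] that V by simp
  qed
  define A where "A j = card {x \<in> O'. \<tau> x = j}" for j
  \<comment> \<open>A colour has degree sum s n over \<open>V\<close>, of which an old colour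
    already receives r m from its given factor; each edge accounts for 3. The divisions are exact by
    admissibility.\<close>
  define T where "T c = (if c < q then (int s * int n - int r * int m) div 3 else int s * int n div 3)" for c
  define D where "D c = (if c < q then (int s - int r) * int m else int s * int m)" for c
  have T3: "3 * T c = (if c < q then int s * int n - int r * int m else int s * int n)" for c
  proof -
    have "3 dvd int s * int n" "3 dvd int r * int m"
      using dvd by (metis int_dvd_int_iff of_nat_mult of_nat_numeral)+
    then show ?thesis by (simp add: T_def)
  qed
  obtain t where t: "n = m + t" "t \<ge> 1" using n by (metis less_imp_add_positive Suc_leI One_nat_def)
  have split: "(\<Sum>c<k. (if c < q then x else y)) = int q * x + (int k - int q) * y" for x y :: int
  proof -
    have "(\<Sum>c<k. (if c < q then x else y)) = (\<Sum>c\<in>{..<k} \<inter> {c. c < q}. x) + (\<Sum>c\<in>{..<k} \<inter> - {c. c < q}. y)"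
      by (rule sum.If_cases) simp
    moreover have "{..<k} \<inter> {c. c < q} = {..<q}" "{..<k} \<inter> - {c. c < q} = {q..<k}" using qk by auto
    ultimately show ?thesis using qk by (simp add: of_nat_diff)
  qed
  define T0 where "T0 = (int s * int n - int r * int m) div 3"
  define T1 where "T1 = int s * int n div 3"
  define D0 where "D0 = (int s - int r) * int m"
  define D1 where "D1 = int s * int m"
  have Tc: "T c = (if c < q then T0 else T1)" for c by (simp add: T_def T0_def T1_def)
  have Dc: "D c = (if c < q then D0 else D1)" for c by (simp add: D_def D0_def D1_def)
  have T01: "3 * T0 = int s * (int m + int t) - int r * int m" "3 * T1 = int s * (int m + int t)"
  proof -
    have "3 dvd int s * int n" "3 dvd int r * int m"
      using dvd by (metis int_dvd_int_iff of_nat_mult of_nat_numeral)+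
    then show "3 * T0 = int s * (int m + int t) - int r * int m" "3 * T1 = int s * (int m + int t)"
      by (simp_all add: T0_def T1_def t(1))
  qed
  have "2 * (int q * int r) = int lam * (2 * int ((m - 1) choose 2))"
    using arg_cong[OF q, of int] by simp
  also have "\<dots> = int lam * ((int m - 1) * (int m - 2))"
    unfolding int_choose_two using m by (simp add: of_nat_diff)
  finally have hq: "2 * (int q * int r) = int lam * ((int m - 1) * (int m - 2))" .
  have "2 * (int k * int s) = int lam * (2 * int ((n - 1) choose 2))"
    using arg_cong[OF k, of int] by simp
  also have "\<dots> = int lam * ((int m + int t - 1) * (int m + int t - 2))"
    unfolding int_choose_two using m t by (simp add: of_nat_diff)
  finally have hk: "2 * (int k * int s) = int lam * ((int m + int t - 1) * (int m + int t - 2))" .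
  have A2: "2 * int (A 2) = int lam * (int t * (int m * (int m - 1)))"
    using cardO[of 2] int_choose_two[of m] by (simp add: A_def t(1))
  have A1: "2 * int (A 1) = int lam * (int m * (int t * (int t - 1)))"
    using cardO[of 1] int_choose_two[of t] by (simp add: A_def t(1) numeral_2_eq_2)
  have A0: "6 * int (A 0) = int lam * (int t * (int t - 1) * (int t - 2))"
    using cardO[of 0] int_choose_three[of t] by (simp add: A_def t(1))
  have iv': "(int k - int q) * int s * (2 * int m - int t) \<le> 3 * int (A 2)"
    using iv cardO[of 2] qk by (simp add: A_def t(1) of_nat_diff algebra_simps)
  have pos: "int m \<ge> 4" "int t \<ge> 1" "int r \<ge> 1" "int s > int r" "int lam \<ge> 1" "0 \<le> int q" "int q \<le> int k"
    using m t r sr lam qk by simp_all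
  have iii': "int m \<le> 2 * int t" if "int q < int k" using iii that t(1) by linarith
  note bounds = type_bounds[OF pos hq hk T01 D0_def D1_def A2 A1 A0 iii' iv']
  have new_bound: "max 0 (D1 - T1) \<le> D1 div 2" if "q < k" using bounds(2) that by simp
  have "\<exists>a. (\<forall>c<k. max 0 (D c - T c) \<le> a c \<and> a c \<le> D c div 2) \<and> (\<Sum>c<k. a c) = int (A 2)"
  proof (rule sum_between)
    show "max 0 (D c - T c) \<le> D c div 2" if "c < k" for c
      using bounds(1) new_bound that by (auto simp: Tc Dc)
    have e: "max 0 (D c - T c) = (if c < q then max 0 (D0 - T0) else max 0 (D1 - T1))"
      "D c div 2 = (if c < q then D0 div 2 else D1 div 2)" for c by (simp_all add: Tc Dc)
    show "(\<Sum>c<k. max 0 (D c - T c)) \<le> int (A 2)" unfolding e split by (rule bounds(3))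
    show "int (A 2) \<le> (\<Sum>c<k. D c div 2)" unfolding e split by (rule bounds(4))
  qed
  then obtain a where range: "\<forall>c<k. max 0 (D c - T c) \<le> a c \<and> a c \<le> D c div 2"
    and sa: "(\<Sum>c<k. a c) = int (A 2)" by blast
  have a: "0 \<le> a c" "D c - T c \<le> a c" "2 * a c \<le> D c" if "c < k" for c
    using range[rule_format, OF that] by linarith+
  have sD: "(\<Sum>c<k. D c) = int (A 1) + 2 * int (A 2)" unfolding Dc split by (rule bounds(5))
  have sT: "(\<Sum>c<k. T c) = int (A 0) + int (A 1) + int (A 2)" unfolding Tc split by (rule bounds(6))
  \<comment> \<open>The solution of the two equations for D and T with \<open>a c\<close> edges of
    type 2. For colours below \<open>k\<close> the bounds on \<open>a c\<close> make all three
    numbers nonnegative, so \<open>nat\<close> truncates nothing.\<close>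
  define num where "num j c = nat (if j = (2::nat) then a c else if j = 1 then D c - 2 * a c
    else T c - D c + a c)" for j c
  have num: "int (num 2 c) = a c" "int (num 1 c) = D c - 2 * a c" "int (num 0 c) = T c - D c + a c"
    if "c < k" for c using a[OF that] by (simp_all add: num_def)
  have "\<exists>f. (\<forall>x\<in>{x \<in> O'. \<tau> x = j}. f x < k) \<and> (\<forall>c<k. card {x \<in> {x \<in> O'. \<tau> x = j}. f x = c} = num j c)"
    if "j \<le> 2" for j
  proof (rule colouring_with_sizes)
    show "finite {x \<in> O'. \<tau> x = j}" using finO by simp
    have "int (\<Sum>c<k. num 2 c) = int (A 2)" using sa num(1) by simp
    moreover have "int (\<Sum>c<k. num 1 c) = int (A 1)"
      using sa sD num(2) by (simp add: sum_subtractf sum_distrib_left[symmetric])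
    moreover have "int (\<Sum>c<k. num 0 c) = int (A 0)"
      using sa sD sT num(3) by (simp add: sum_subtractf sum.distrib)
    moreover have "j = 0 \<or> j = 1 \<or> j = 2" using that by linarith
    ultimately show "card {x \<in> O'. \<tau> x = j} = (\<Sum>c<k. num j c)"
      by (auto simp: A_def simp del: of_nat_sum)
  qed
  then have "\<forall>j\<in>{..2}. \<exists>f. (\<forall>x\<in>{x \<in> O'. \<tau> x = j}. f x < k) \<and>
      (\<forall>c<k. card {x \<in> {x \<in> O'. \<tau> x = j}. f x = c} = num j c)" by blast
  from bchoice[OF this] obtain f where f0: "\<forall>j\<in>{..2}. (\<forall>x\<in>{x \<in> O'. \<tau> x = j}. f j x < k) \<and>
      (\<forall>c<k. card {x \<in> {x \<in> O'. \<tau> x = j}. f j x = c} = num j c)" by blast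
  have f: "\<And>x. x \<in> {x \<in> O'. \<tau> x = j} \<Longrightarrow> f j x < k"
    "\<And>c. c < k \<Longrightarrow> card {x \<in> {x \<in> O'. \<tau> x = j}. f j x = c} = num j c" if "j \<le> 2" for j
    using bspec[OF f0, of j] that by blast+
  \<comment> \<open>Within a type the colours are assigned arbitrarily: only the degree sums over
    \<open>U\<close> and V - U are right so far.\<close>
  define col0 where "col0 x = f (\<tau> x) x" for x
  have col0: "col0 x < k" if "x \<in> O'" for x using f(1)[OF O3(4)[OF that]] that by (simp add: col0_def)
  have size0: "card {x \<in> {x \<in> O'. col0 x = c}. \<tau> x = j} = num j c" if "j \<le> 2" "c < k" for j c
  proof -
    have "{x \<in> {x \<in> O'. col0 x = c}. \<tau> x = j} = {x \<in> {x \<in> O'. \<tau> x = j}. f j x = c}"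
      by (auto simp: col0_def)
    then show ?thesis using f(2)[OF that] by simp
  qed
  have sumU: "(\<Sum>y\<in>U. degree {x \<in> O'. col0 x = c} y) = (if c < q then s - r else s) * card U"
    if c: "c < k" for c
  proof -
    let ?C = "{x \<in> O'. col0 x = c}"
    have "finite ?C" using finO by simp
    then have "(\<Sum>y\<in>U. degree ?C y) = (\<Sum>x\<in>?C. \<tau> x)" by (simp add: sum_degree finU \<tau>_def)
    also have "\<dots> = 0 * card {x \<in> ?C. \<tau> x = 0} + 1 * card {x \<in> ?C. \<tau> x = 1} + 2 * card {x \<in> ?C. \<tau> x = 2}"
      by (rule sum_by_type[OF \<open>finite ?C\<close>]) (use O3(4) in blast)
    also have "\<dots> = num 1 c + 2 * num 2 c" using size0[OF _ c, of 1] size0[OF _ c, of 2] by simp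
    finally have "int (\<Sum>y\<in>U. degree ?C y) = D c" using num[OF c] by simp
    also have "\<dots> = int ((if c < q then s - r else s) * card U)"
      using sr V(4) by (simp add: D_def of_nat_diff)
    finally show ?thesis by (simp only: of_nat_eq_iff)
  qed
  have sumW: "(\<Sum>y\<in>V - U. degree {x \<in> O'. col0 x = c} y) = s * card (V - U)"
    if c: "c < k" for c
  proof -
    let ?C = "{x \<in> O'. col0 x = c}"
    have "finite ?C" using finO by simp
    have compl: "card (fst x \<inter> (V - U)) = 3 - \<tau> x" if "x \<in> O'" for x
    proof -
      have "fst x \<inter> (V - U) = fst x - U" using O3(1)[OF that] by blast
      then show ?thesis using card_Diff_subset_Int[of "fst x" U] O3[OF that] by (simp add: \<tau>_def)
    qed
    have "(\<Sum>y\<in>V - U. degree ?C y) = (\<Sum>x\<in>?C. card (fst x \<inter> (V - U)))"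
      using \<open>finite ?C\<close> V(1) by (simp add: sum_degree)
    also have "\<dots> = (3 - 0) * card {x \<in> ?C. \<tau> x = 0} + (3 - 1) * card {x \<in> ?C. \<tau> x = 1} +
        (3 - 2) * card {x \<in> ?C. \<tau> x = 2}"
      by (rule sum_by_type[OF \<open>finite ?C\<close>]) (use O3(4) compl in blast)
    also have "\<dots> = 3 * num 0 c + 2 * num 1 c + num 2 c"
      using size0[OF _ c, of 0] size0[OF _ c, of 1] size0[OF _ c, of 2] by simp
    finally have "int (\<Sum>y\<in>V - U. degree ?C y) = 3 * T c - D c" using num[OF c] by simp
    also have "\<dots> = int s * (int n - int m)"
      using T3[of c] by (simp add: D_def algebra_simps)
    also have "\<dots> = int (s * card (V - U))"
      using V finU n by (simp add: card_Diff_subset of_nat_diff)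
    finally show ?thesis by (simp only: of_nat_eq_iff)
  qed
  have closed: "swap_edge v w x \<in> O'"
    if "v \<in> V" "w \<in> V" "(v \<in> U) = (w \<in> U)" "x \<in> O'" for v w x
  proof -
    have "swap_edge v w x \<in> complete_edges lam 3 V"
      using swap_edge_complete_edges[of x lam 3 V v w] that by (simp add: O'_def)
    moreover have "\<not> fst x \<subseteq> U" using that(4) by (auto simp: O'_def complete_edges_def)
    then have "\<not> fst (swap_edge v w x) \<subseteq> U" using swap_edge_inside[OF that(3), of x] by blast
    ultimately show ?thesis by (auto simp: O'_def complete_edges_def)
  qed
  obtain col where col: "\<And>x. x \<in> O' \<Longrightarrow> col x < k"
    "\<And>c a. (\<Sum>y | y \<in> V \<and> (y \<in> U) = a. degree {x \<in> O'. col x = c} y) =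
      (\<Sum>y | y \<in> V \<and> (y \<in> U) = a. degree {x \<in> O'. col0 x = c} y)"
    "\<And>c v w. v \<in> V \<Longrightarrow> w \<in> V \<Longrightarrow> (v \<in> U) = (w \<in> U) \<Longrightarrow>
      \<bar>int (degree {x \<in> O'. col x = c} v) - int (degree {x \<in> O'. col x = c} w)\<bar> \<le> 1"
  proof -
    show thesis
    proof (rule balanced_colouring[where side = "\<lambda>y. y \<in> U", OF V(1) finO col0 closed],
        assumption+, goal_cases)
      case (1 col)
      show ?case by (rule that[OF 1])
    qed
  qed
  have sides: "{y. y \<in> V \<and> (y \<in> U) = True} = U" "{y. y \<in> V \<and> (y \<in> U) = False} = V - U"
    using V(3) by auto
  show thesis
  proof (rule that[OF col(1)])
    show "degree {x \<in> O'. col x = c} y = (if c < q then s - r else s)" if "c < k" "y \<in> U" for c y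
    proof (rule balanced_sum_eq[OF finU _ _ that(2)])
      show "(\<Sum>y\<in>U. degree {x \<in> O'. col x = c} y) = (if c < q then s - r else s) * card U"
        using col(2)[of c True] sumU[OF that(1)] unfolding sides by simp
    qed (use col(3) V(3) in blast)
    show "degree {x \<in> O'. col x = c} y = s" if "c < k" "y \<in> V - U" for c y
    proof (rule balanced_sum_eq[OF _ _ _ that(2)])
      show "(\<Sum>y\<in>V - U. degree {x \<in> O'. col x = c} y) = s * card (V - U)"
        using col(2)[of c False] sumW[OF that(1)] unfolding sides by simp
    qed (use col(3) V(1) in auto)
  qed
qed

lemma embeds_connected_if:
  fixes V U :: "'a set" and m n r s lam k q :: nat
  assumes m: "m > 3" and n: "n > m" and r: "r > 0" and lam: "lam > 0" and sr: "r < s"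
    and V: "finite V" "card V = n" "U \<subseteq> V" "card U = m"
    and F: "is_factorization r U (complete_edges lam 3 U) F"
    and qk: "card F \<le> k" and k: "k * s = lam * ((n - 1) choose 2)"
    and dvd: "3 dvd r * m" "3 dvd s * n"
    and iii: "card F < k \<Longrightarrow> 3 * m \<le> 2 * n"
    and iv: "(3 * int m - int n) * int ((k - card F) * s) \<le> 3 * int (lam * ((n - m) * (m choose 2)))"
  shows "embeds_connected F s V (complete_edges lam 3 V)"
proof -
  define E where "E = complete_edges lam 3 V"
  define I where "I = complete_edges lam 3 U"
  define q where "q = card F"
  have finU: "finite U" using V finite_subset by blast
  have "U \<noteq> {}" using V(4) m by auto
  have finE: "finite E" unfolding E_def by (rule finite_complete_edges[OF V(1)])
  have IE: "I \<subseteq> E" using V(3) by (auto simp: I_def E_def complete_edges_def)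
  have finI: "finite I" using IE finE finite_subset by blast
  have inner: "x \<in> I \<longleftrightarrow> fst x \<subseteq> U" if "x \<in> E" for x
    using that by (auto simp: I_def E_def complete_edges_def)
  have partF: "\<Union>F = I" "disjoint F" "{} \<notin> F" using F by (auto simp: is_factorization_def partition_on_def I_def)
  have degF: "degree P u = r" if "P \<in> F" "u \<in> U" for P u
    using F that by (auto simp: is_factorization_def is_factor_def)
  have "finite F" using partF(1) finI by (metis finite_UnionD)
  \<comment> \<open>The given factors become the colours below \<open>q\<close>, matching the
    convention of \<open>outer_colouring\<close>, where these colours still lack the degree s - r on
    \<open>U\<close>.\<close>
  then obtain h where h: "bij_betw h F {..<q}"
    using ex_bij_betw_finite_nat[of F] unfolding q_def atLeast0LessThan by blast
  have hlt: "h P < q" if "P \<in> F" for P using bij_betwE[OF h] that by blast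
  have hinj: "P = P'" if "h P = h P'" "P \<in> F" "P' \<in> F" for P P'
    using inj_onD[OF bij_betw_imp_inj_on[OF h] that] .
  have hq: "q * r = lam * ((m - 1) choose 2)"
    using card_factorization[OF F finU \<open>U \<noteq> {}\<close>] V(4) by (simp add: q_def)
  obtain colO where colO: "\<And>x. x \<in> E - I \<Longrightarrow> colO x < k"
    "\<And>c y. c < k \<Longrightarrow> y \<in> U \<Longrightarrow> degree {x \<in> E - I. colO x = c} y = (if c < q then s - r else s)"
    "\<And>c y. c < k \<Longrightarrow> y \<in> V - U \<Longrightarrow> degree {x \<in> E - I. colO x = c} y = s"
  proof -
    show thesis
    proof (rule outer_colouring[OF m n r lam sr V qk[folded q_def] hq k dvd iii[folded q_def]
          iv[folded q_def], folded E_def I_def], assumption+, goal_cases)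
      case (1 col)
      show ?case by (rule that[OF 1])
    qed
  qed
  define ic where "ic x = h (THE P. P \<in> F \<and> x \<in> P)" for x
  have ic: "ic x = h P" if "P \<in> F" "x \<in> P" for x P
  proof -
    have "(THE P. P \<in> F \<and> x \<in> P) = P"
    proof (rule the_equality)
      fix P' assume "P' \<in> F \<and> x \<in> P'"
      then show "P' = P" using partF(2) that unfolding disjoint_def by blast
    qed (use that in blast)
    then show ?thesis by (simp add: ic_def)
  qed
  have icP: "{x \<in> I. ic x = h P} = P" if P: "P \<in> F" for P
  proof
    show "{x \<in> I. ic x = h P} \<subseteq> P"
    proof
      fix x assume x: "x \<in> {x \<in> I. ic x = h P}"
      then obtain P' where P': "P' \<in> F" "x \<in> P'" using partF(1) by blast
      then have "h P' = h P" using ic[OF P'] x by simp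
      then show "x \<in> P" using hinj P' P by blast
    qed
    show "P \<subseteq> {x \<in> I. ic x = h P}" using ic[OF P] partF(1) P by blast
  qed
  have deg_inner: "degree {x \<in> I. ic x = c} u = (if c < q then r else 0)" if u: "u \<in> U" for c u
  proof (cases "c < q")
    case True
    then have "c \<in> h ` F" using bij_betw_imp_surj_on[OF h] by blast
    then obtain P where "P \<in> F" "c = h P" by blast
    then show ?thesis using icP degF u True by simp
  next
    case False
    have "ic x \<noteq> c" if x: "x \<in> I" for x
    proof -
      obtain P where P: "P \<in> F" "x \<in> P" using x partF(1) by blast
      show ?thesis using ic[OF P] hlt[OF P(1)] False by simp
    qed
    then have empty: "{x \<in> I. ic x = c} = {}" by blast
    show ?thesis unfolding empty using False by (simp add: degree_def)
  qed
  have deg_inner_out: "degree {x \<in> I. ic x = c} y = 0" if "y \<notin> U" for c y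
  proof -
    have empty: "{x \<in> {x \<in> I. ic x = c}. y \<in> fst x} = {}"
      using that by (auto simp: I_def complete_edges_def)
    show ?thesis unfolding degree_def empty by simp
  qed
  define col where "col x = (if x \<in> I then ic x else colO x)" for x
  have col_lt: "col x < k" if x: "x \<in> E" for x
  proof (cases "x \<in> I")
    case True
    then obtain P where P: "P \<in> F" "x \<in> P" using partF(1) by blast
    show ?thesis using ic[OF P] hlt[OF P(1)] True qk by (simp add: col_def q_def)
  qed (use colO(1) x in \<open>simp add: col_def\<close>)
  have col_split: "{x \<in> E. col x = c} = {x \<in> I. ic x = c} \<union> {x \<in> E - I. colO x = c}" for c
    using IE by (auto simp: col_def)
  have deg_col: "degree {x \<in> E. col x = c} y = s" if "c < k" "y \<in> V" for c y
  proof -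
    have "degree {x \<in> E. col x = c} y = degree {x \<in> I. ic x = c} y + degree {x \<in> E - I. colO x = c} y"
      unfolding col_split by (rule degree_Un_disjoint) (use finI finE in auto)
    then show ?thesis
      using deg_inner[of y c] deg_inner_out[of y c] colO(2,3)[of c y] that sr by (cases "y \<in> U") auto
  qed
  \<comment> \<open>The inner degree is r or 0. Because r < s, every vertex of \<open>U\<close> has
    an edge leaving \<open>U\<close> in every colour, as connecting requires.\<close>
  have inner_less: "degree {x \<in> E. fst x \<subseteq> U \<and> col x = c} u < s" if "c < k" "u \<in> V" "u \<in> U" for c u
  proof -
    have "x \<in> E \<and> fst x \<subseteq> U \<longleftrightarrow> x \<in> I" for x using inner[of x] IE by blast
    then have eq: "{x \<in> E. fst x \<subseteq> U \<and> col x = c} = {x \<in> I. ic x = c}"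
      by (auto simp: col_def)
    show ?thesis unfolding eq using deg_inner[OF that(3), of c] sr by simp
  qed
  have edgesE: "fst e \<subseteq> V \<and> card (fst e) = 3" if "e \<in> E" for e
    using that by (auto simp: E_def complete_edges_def)
  have closed: "swap_edge v w x \<in> E" if "v \<in> V - U" "w \<in> V - U" "x \<in> E" for v w x
    using swap_edge_complete_edges[of x lam 3 V v w] that by (simp add: E_def)
  have s2: "s \<ge> 2" using r sr by simp
  obtain col' where c': "\<And>x. x \<in> E \<Longrightarrow> col' x < k" "\<And>x. x \<in> E \<Longrightarrow> fst x \<subseteq> U \<Longrightarrow> col' x = col x"
    "\<And>c y. c < k \<Longrightarrow> y \<in> V \<Longrightarrow> degree {x \<in> E. col' x = c} y = s"
    "\<And>c. c < k \<Longrightarrow> hconnected V {x \<in> E. col' x = c}"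
  proof -
    show thesis
    proof (rule connected_recolouring[OF V(1) finE edgesE closed col_lt deg_col s2 inner_less],
        assumption+, goal_cases)
      case (1 col')
      show ?case by (rule that[OF 1])
    qed
  qed
  define cls where "cls c = {x \<in> E. col' x = c}" for c
  have "V \<noteq> {}" using V(2) n by auto
  then obtain v where v: "v \<in> V" by blast
  have ne: "cls c \<noteq> {}" if "c < k" for c
    using c'(3)[OF that v] s2 unfolding cls_def degree_def by force
  have cls_inj: "c = d" if "cls c = cls d" "c < k" for c d
    using ne[OF that(2)] that(1) unfolding cls_def by blast
  have "is_factorization s V E (cls ` {..<k})"
    unfolding is_factorization_def is_factor_def partition_on_def disjoint_def
  proof (intro conjI ballI impI)
    show "\<Union> (cls ` {..<k}) = E" using c'(1) by (auto simp: cls_def)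
    show "{} \<notin> cls ` {..<k}" using ne by blast
  qed (use c'(3) in \<open>auto simp: cls_def\<close>)
  moreover have "\<forall>H\<in>cls ` {..<k}. hconnected V H" using c'(4) by (auto simp: cls_def)
  moreover have hk: "h P < k" if "P \<in> F" for P using hlt[OF that] qk by (simp add: q_def)
  then have "(cls \<circ> h) ` F \<subseteq> cls ` {..<k}" by auto
  moreover have "inj_on (cls \<circ> h) F"
  proof (rule inj_onI)
    fix P P' assume "P \<in> F" "P' \<in> F" "(cls \<circ> h) P = (cls \<circ> h) P'"
    then show "P = P'" using cls_inj[of "h P" "h P'"] hk[of P] hinj by simp
  qed
  moreover have "P \<subseteq> (cls \<circ> h) P" if P: "P \<in> F" for P
  proof
    fix x assume x: "x \<in> P"
    have "x \<in> I" using P x partF(1) by blast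
    then have "x \<in> E" using IE by blast
    have "fst x \<subseteq> U" using inner[OF \<open>x \<in> E\<close>] \<open>x \<in> I\<close> by blast
    then show "x \<in> (cls \<circ> h) P" using c'(2)[OF \<open>x \<in> E\<close>] \<open>x \<in> E\<close> ic[OF P x] \<open>x \<in> I\<close> by (simp add: cls_def col_def)
  qed
  ultimately show ?thesis unfolding embeds_connected_def E_def by blast
qed

section \<open>Necessity of the conditions\<close>

text \<open>If r were not below s, the given factor would use up all edges of \<open>H\<close> at
  vertices of \<open>U\<close>. No edge of \<open>H\<close> would then leave \<open>U\<close>,
  although \<open>H\<close> connects \<open>U\<close> with the rest of \<open>V\<close>.\<close>

lemma factor_degree_less_if_connected:
  assumes "is_factor r U I P" "is_factor s V E H" "P \<subseteq> H" "finite H" "hconnected V H"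
    and "\<And>x. x \<in> I \<Longrightarrow> fst x \<subseteq> U" "U \<subset> V" "U \<noteq> {}"
  shows "r < s"
proof (rule ccontr)
  assume "\<not> r < s"
  have same: "x \<in> P" if "x \<in> H" "u \<in> U" "u \<in> fst x" for x u
  proof -
    have "card {x \<in> H. u \<in> fst x} = s" "card {x \<in> P. u \<in> fst x} = r"
      using assms(1,2,7) that(2) by (auto simp: is_factor_def degree_def)
    moreover have "{x \<in> P. u \<in> fst x} \<subseteq> {x \<in> H. u \<in> fst x}" using assms(3) by blast
    ultimately have "{x \<in> P. u \<in> fst x} = {x \<in> H. u \<in> fst x}"
      using \<open>\<not> r < s\<close> assms(4) by (intro card_seteq) auto
    then show ?thesis using that by blast
  qed
  obtain u v where uv: "u \<in> U" "v \<in> V" "v \<notin> U" using assms(7,8) by blast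
  then have "(u, v) \<in> reach {} H" using assms(5,7) by (auto simp: hconnected_iff_reach)
  then have "v \<in> U"
  proof (induction rule: reach_induct)
    case (step y z e)
    then have "e \<in> P" using same by blast
    then have "e \<in> I" using assms(1) by (auto simp: is_factor_def)
    then have "fst e \<subseteq> U" by (rule assms(6))
    then show ?case using step by blast
  qed (rule uv)
  then show False using uv by blast
qed

lemma embeds_connected_only_if:
  fixes V U :: "'a set" and m n r s lam :: nat
  assumes m: "m > 3" and n: "n > m" and r: "r > 0" and s: "s > 0" and lam: "lam > 0"
    and V: "finite V" "card V = n" "U \<subseteq> V" "card U = m"
    and F: "is_factorization r U (complete_edges lam 3 U) F"
    and emb: "embeds_connected F s V (complete_edges lam 3 V)"
  obtains k where "card F \<le> k" "k * s = lam * ((n - 1) choose 2)" "r < s" "admissible 3 n s lam"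
    "card F < k \<Longrightarrow> 3 * m \<le> 2 * n"
    "(3 * int m - int n) * int ((k - card F) * s) \<le> 3 * int (lam * ((n - m) * (m choose 2)))"
proof -
  define E where "E = complete_edges lam 3 V"
  define I where "I = complete_edges lam 3 U"
  from emb[unfolded embeds_connected_def, folded E_def] obtain G where
    G0: "is_factorization s V E G \<and> (\<forall>H\<in>G. hconnected V H) \<and>
      (\<exists>f. f ` F \<subseteq> G \<and> inj_on f F \<and> (\<forall>P\<in>F. P \<subseteq> f P))" ..
  then have "\<exists>f. f ` F \<subseteq> G \<and> inj_on f F \<and> (\<forall>P\<in>F. P \<subseteq> f P)" by (elim conjE)
  then obtain f where f0: "f ` F \<subseteq> G \<and> inj_on f F \<and> (\<forall>P\<in>F. P \<subseteq> f P)" ..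
  have G: "is_factorization s V E G" "\<And>H. H \<in> G \<Longrightarrow> hconnected V H" using G0 by simp_all
  have f: "f ` F \<subseteq> G" "inj_on f F" "\<And>P. P \<in> F \<Longrightarrow> P \<subseteq> f P" using f0 by simp_all
  have finU: "finite U" using V finite_subset by blast
  have finE: "finite E" unfolding E_def by (rule finite_complete_edges[OF V(1)])
  have UV: "U \<noteq> {}" "V \<noteq> {}" "U \<subset> V" using V m n by auto
  have partG: "\<Union>G = E" "disjoint G" using G(1) by (auto simp: is_factorization_def partition_on_def)
  have facG: "is_factor s V E H" if "H \<in> G" for H using G(1) that by (simp add: is_factorization_def)
  have facF: "is_factor r U I P" if "P \<in> F" for P using F that by (simp add: is_factorization_def I_def)
  have UF: "\<Union>F = I" using F by (simp add: is_factorization_def partition_on_def I_def)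
  have finG: "finite G" using partG(1) finE by (metis finite_UnionD)
  have finH: "finite H" if "H \<in> G" for H using that partG(1) finE by (meson Union_upper finite_subset)
  have k: "card G * s = lam * ((n - 1) choose 2)"
    using card_factorization[OF G(1)[unfolded E_def] V(1) UV(2)] V(2) by simp
  have adm: "admissible 3 n s lam"
    using admissible_if_factorization[OF G(1)[unfolded E_def] V(1)] V(2) m n lam by simp
  have "I \<noteq> {}" unfolding I_def using complete_edges_nonempty[OF finU] V(4) m lam by simp
  then obtain P where P: "P \<in> F" using UF by blast
  have fP: "f P \<in> G" using P f(1) by blast
  have sr: "r < s"
    using factor_degree_less_if_connected[OF facF[OF P] facG[OF fP] f(3)[OF P] finH[OF fP] G(2)[OF fP] _ UV(3,1)]
    by (auto simp: I_def complete_edges_def)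
  define N where "N = G - f ` F"
  have cardN: "card N = card G - card F"
    unfolding N_def using f(1,2) finG by (simp add: card_Diff_subset finite_subset card_image)
  have qk: "card F \<le> card G" using card_inj_on_le[OF f(2,1) finG] .
  define a where "a H = card {x \<in> H. card (fst x \<inter> U) = 2}" for H :: "'a medge set"
  \<comment> \<open>The first inequality amounts to s m \<le> \<open>card H + a H\<close>: an edge
    counts at most once for the degree sum over \<open>U\<close>, and once more if it meets
    \<open>U\<close> in two vertices. It yields (iv) on summation over \<open>N\<close>, and the
    second yields (iii).\<close>
  have new: "2 * card H + a H \<ge> s * m + card H" "2 * card H \<ge> s * m" "3 * card H = s * n"
    if H: "H \<in> N" for H
  proof -
    have HG: "H \<in> G" using H by (simp add: N_def)
    have HE: "H \<subseteq> E" using partG(1) HG by blast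
    \<comment> \<open>An edge inside \<open>U\<close> lies in some given factor \<open>P\<close>,
      hence in \<open>f P\<close>, and so in no other member of \<open>G\<close>.\<close>
    have ninner: "\<not> fst x \<subseteq> U" if x: "x \<in> H" for x
    proof
      assume "fst x \<subseteq> U"
      moreover have "x \<in> E" using HE x by blast
      ultimately have "x \<in> I" by (auto simp: I_def E_def complete_edges_def)
      then obtain P where P: "P \<in> F" "x \<in> P" using UF by blast
      then have "x \<in> f P" "f P \<in> G" using f(1,3) by blast+
      then have "f P = H" using partG(2) HG x unfolding disjoint_def by blast
      then show False using H P(1) by (auto simp: N_def)
    qed
    have le2: "card (fst x \<inter> U) \<le> 2" if x: "x \<in> H" for x
    proof -
      have "x \<in> E" using HE x by blast
      then have "card (fst x) = 3" by (auto simp: E_def complete_edges_def)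
      moreover from this have "finite (fst x)" by (metis card.infinite zero_neq_numeral)
      moreover have "fst x \<inter> U \<subset> fst x" using ninner[OF x] by blast
      ultimately show ?thesis using psubset_card_mono[of "fst x" "fst x \<inter> U"] by simp
    qed
    have "(\<Sum>x\<in>H. card (fst x \<inter> U)) = (\<Sum>u\<in>U. degree H u)"
      using sum_degree[OF finH[OF HG] finU] by simp
    also have "\<dots> = s * m" using facG[OF HG] V by (auto simp: is_factor_def subset_iff)
    finally have sm: "(\<Sum>x\<in>H. card (fst x \<inter> U)) = s * m" .
    show "3 * card H = s * n" using card_factor[OF facG[OF HG, unfolded E_def] V(1)] V(2) by simp
    have "s * m \<le> (\<Sum>x\<in>H. 2)" unfolding sm[symmetric] by (rule sum_mono) (rule le2)
    then show "2 * card H \<ge> s * m" by simp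
    have "s * m \<le> (\<Sum>x\<in>H. 1 + (if card (fst x \<inter> U) = 2 then 1 else 0))"
      unfolding sm[symmetric] by (rule sum_mono) (use le2 in fastforce)
    also have "\<dots> = card H + a H"
      unfolding sum.distrib a_def using finH[OF HG] by (simp add: sum.inter_filter[symmetric])
    finally show "2 * card H + a H \<ge> s * m + card H" by simp
  qed
  have iii: "3 * m \<le> 2 * n" if "card F < card G"
  proof -
    have "card N > 0" using cardN that by simp
    then obtain H where H: "H \<in> N" by (metis card.empty equals0I less_irrefl)
    have "3 * (s * m) \<le> 2 * (s * n)" using new(2,3)[OF H] by linarith
    then have "s * (3 * m) \<le> s * (2 * n)" by (simp only: mult.left_commute)
    then show ?thesis using s by simp
  qed
  have "(\<Sum>H\<in>N. a H) = card (\<Union>H\<in>N. {x \<in> H. card (fst x \<inter> U) = 2})"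
    unfolding a_def
  proof (rule card_UN_disjoint[symmetric])
    show "finite N" using finG by (simp add: N_def)
    show "\<forall>H\<in>N. finite {x \<in> H. card (fst x \<inter> U) = 2}" using finH by (simp add: N_def)
    show "\<forall>H\<in>N. \<forall>H'\<in>N. H \<noteq> H' \<longrightarrow>
        {x \<in> H. card (fst x \<inter> U) = 2} \<inter> {x \<in> H'. card (fst x \<inter> U) = 2} = {}"
      using partG(2) unfolding disjoint_def N_def by blast
  qed
  also have "\<dots> \<le> card {x \<in> E. card (fst x \<inter> U) = 2}"
    using partG(1) finE by (intro card_mono) (auto simp: N_def)
  also have "\<dots> = lam * ((n - m) * (m choose 2))"
    using card_complete_edges_meeting[OF V(1,3), of 2 3 lam] V by (simp add: E_def mult.commute)
  finally have total: "(\<Sum>H\<in>N. a H) \<le> lam * ((n - m) * (m choose 2))" .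
  have "(3 * int m - int n) * int s \<le> 3 * int (a H)" if H: "H \<in> N" for H
  proof -
    have "int s * int m \<le> int (card H) + int (a H)" "3 * int (card H) = int s * int n"
      using new(1,3)[OF H] by (simp_all flip: of_nat_mult of_nat_add)
    then have "3 * (int s * int m) - int s * int n \<le> 3 * int (a H)" by linarith
    then show ?thesis by (simp add: algebra_simps)
  qed
  then have "(\<Sum>H\<in>N. (3 * int m - int n) * int s) \<le> (\<Sum>H\<in>N. 3 * int (a H))" by (rule sum_mono)
  also have "\<dots> = 3 * int (\<Sum>H\<in>N. a H)" by (simp add: sum_distrib_left)
  also have "\<dots> \<le> 3 * int (lam * ((n - m) * (m choose 2)))"
    using total by (intro mult_left_mono) (simp_all only: of_nat_le_iff zero_le_numeral)
  finally have "(3 * int m - int n) * int ((card G - card F) * s) \<le> 3 * int (lam * ((n - m) * (m choose 2)))"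
    by (simp only: sum_constant cardN of_nat_mult mult_ac)
  from that[OF qk k sr adm iii this] show thesis .
qed

section \<open>The conditions in terms of the numbers of factors\<close>

text \<open>Multiplication by \<open>lam\<close> turns the binomials into numbers of factors, so s/r
  against the quotient of binomials is q against k. In the same way \<open>lam\<close> times the
  bracket in (iv) is \<open>(k - q) * s\<close>, the degree of a vertex in the union of the new
  factors; a further factor 3 clears the third.\<close>

lemma numeric_conditions:
  fixes m n r s lam k q :: nat
  assumes m: "m > 3" and n: "n > m" and r: "r > 0" and s: "s > 0" and lam: "lam > 0"
    and q: "q * r = lam * ((m - 1) choose 2)" and k: "k * s = lam * ((n - 1) choose 2)"
  shows "(1 < real s / real r \<and> real s / real r \<le> real ((n - 1) choose 2) / real ((m - 1) choose 2)) \<longleftrightarrow>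
      r < s \<and> q \<le> k"
    and "r * ((n - 1) choose 2) > s * ((m - 1) choose 2) \<longleftrightarrow> q < k"
    and "q \<le> k \<Longrightarrow> (real n - real m) * real (m choose 2) \<ge>
        (real m - real n / 3) * (real ((n - 1) choose 2) - real s / real r * real ((m - 1) choose 2)) \<longleftrightarrow>
      (3 * int m - int n) * int ((k - q) * s) \<le> 3 * int (lam * ((n - m) * (m choose 2)))"
proof -
  define a b where "a = (m - 1) choose 2" and "b = (n - 1) choose 2"
  have a: "a > 0" using m by (simp add: a_def)
  have lamq: "lam * (s * a) = (r * s) * q" using q by (simp add: a_def algebra_simps)
  have lamk: "lam * (r * b) = (r * s) * k" using k by (simp add: b_def algebra_simps)
  have le: "s * a \<le> r * b \<longleftrightarrow> q \<le> k"
  proof -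
    have "s * a \<le> r * b \<longleftrightarrow> lam * (s * a) \<le> lam * (r * b)" using lam by simp
    also have "\<dots> \<longleftrightarrow> q \<le> k" unfolding lamq lamk using r s by simp
    finally show ?thesis .
  qed
  then show "r * ((n - 1) choose 2) > s * ((m - 1) choose 2) \<longleftrightarrow> q < k"
  proof -
    have "s * a < r * b \<longleftrightarrow> lam * (s * a) < lam * (r * b)" using lam by simp
    also have "\<dots> \<longleftrightarrow> q < k" unfolding lamq lamk using r s by simp
    finally show ?thesis by (simp add: a_def b_def)
  qed
  have "real s / real r \<le> real b / real a \<longleftrightarrow> real s * real a \<le> real r * real b"
    using r a by (simp add: field_simps)
  also have "\<dots> \<longleftrightarrow> s * a \<le> r * b" by (metis of_nat_mult of_nat_le_iff)
  finally show "(1 < real s / real r \<and> real s / real r \<le> real ((n - 1) choose 2) / real ((m - 1) choose 2)) \<longleftrightarrow>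
      r < s \<and> q \<le> k" using le r by (simp add: a_def b_def)
  assume qk: "q \<le> k"
  have rq: "real q * real r = real lam * real a" using arg_cong[OF q, of real] by (simp add: a_def)
  have rk: "real k * real s = real lam * real b" using arg_cong[OF k, of real] by (simp add: b_def)
  have diff: "real lam * (real b - real s / real r * real a) = real ((k - q) * s)"
  proof -
    have "real lam * (real s / real r * real a) = (real s / real r) * (real lam * real a)" by simp
    also have "\<dots> = real q * real s" unfolding rq[symmetric] using r by simp
    finally show ?thesis using rk qk by (simp add: right_diff_distrib of_nat_diff algebra_simps)
  qed
  have clear_third: "(3 * l) * ((x - y / 3) * z) = (3 * x - y) * (l * z)" for l x y z :: real
    by (simp add: algebra_simps)
  have "(real m - real n / 3) * (real b - real s / real r * real a) \<le> (real n - real m) * real (m choose 2) \<longleftrightarrow>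
      (3 * real lam) * ((real m - real n / 3) * (real b - real s / real r * real a)) \<le>
      (3 * real lam) * ((real n - real m) * real (m choose 2))" using lam by simp
  also have "(3 * real lam) * ((real m - real n / 3) * (real b - real s / real r * real a)) =
      (3 * real m - real n) * (real lam * (real b - real s / real r * real a))"
    by (rule clear_third)
  also have "\<dots> = real_of_int ((3 * int m - int n) * int ((k - q) * s))" unfolding diff by simp
  also have "(3 * real lam) * ((real n - real m) * real (m choose 2)) =
      real_of_int (3 * int (lam * ((n - m) * (m choose 2))))" using n by (simp add: of_nat_diff)
  finally show "(real n - real m) * real (m choose 2) \<ge>
        (real m - real n / 3) * (real ((n - 1) choose 2) - real s / real r * real ((m - 1) choose 2)) \<longleftrightarrow>
      (3 * int m - int n) * int ((k - q) * s) \<le> 3 * int (lam * ((n - m) * (m choose 2)))"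
    unfolding a_def b_def of_int_le_iff .
qed

theorem theorem8p5:
  fixes m n r s lam :: nat and U V :: "'a set" and F :: "'a medge set set"
  assumes "m > 3" and "n > m" and "r > 0" and "s > 0" and "lam > 0"
    and "finite V" and "card V = n" and "U \<subseteq> V" and "card U = m"
    and "is_factorization r U (complete_edges lam 3 U) F"
  shows "embeds_connected F s V (complete_edges lam 3 V) \<longleftrightarrow>
    (admissible 3 m r lam \<and> admissible 3 n s lam) \<and>
    (1 < real s / real r \<and>
     real s / real r \<le> real ((n - 1) choose 2) / real ((m - 1) choose 2)) \<and>
    (r * ((n - 1) choose 2) > s * ((m - 1) choose 2) \<longrightarrow> real n \<ge> 3 * real m / 2) \<and>
    (real n - real m) * real (m choose 2) \<ge>
      (real m - real n / 3) *
        (real ((n - 1) choose 2) - real s / real r * real ((m - 1) choose 2))"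
    (is "?emb \<longleftrightarrow> ?adm \<and> ?ii \<and> (?new \<longrightarrow> ?iii) \<and> ?iv")
proof -
  have U: "finite U" "U \<noteq> {}" using assms(1,6,8,9) finite_subset by auto
  have admU: "admissible 3 m r lam"
    using admissible_if_factorization[OF assms(10) U(1)] assms(1,5,9) by simp
  have q: "card F * r = lam * ((m - 1) choose 2)"
    using card_factorization[OF assms(10) U] assms(9) by simp
  have iii: "?iii \<longleftrightarrow> 3 * m \<le> 2 * n" by linarith
  show ?thesis
  proof
    assume ?emb
    from embeds_connected_only_if[OF assms this] obtain k where
      k: "card F \<le> k" "k * s = lam * ((n - 1) choose 2)" "r < s" "admissible 3 n s lam"
        "card F < k \<Longrightarrow> 3 * m \<le> 2 * n"
        "(3 * int m - int n) * int ((k - card F) * s) \<le> 3 * int (lam * ((n - m) * (m choose 2)))"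
      by blast
    note num = numeric_conditions[OF assms(1-5) q k(2)]
    show "?adm \<and> ?ii \<and> (?new \<longrightarrow> ?iii) \<and> ?iv"
      using admU k num(1,2) num(3)[OF k(1)] iii by blast
  next
    assume R: "?adm \<and> ?ii \<and> (?new \<longrightarrow> ?iii) \<and> ?iv"
    then have "s dvd lam * ((n - 1) choose 2)" by (simp add: admissible_def)
    then obtain k where k: "k * s = lam * ((n - 1) choose 2)" by (metis dvd_def mult.commute)
    note num = numeric_conditions[OF assms(1-5) q k]
    have sr: "r < s" and qk: "card F \<le> k" using R num(1) by blast+
    have dvd: "3 dvd r * m" "3 dvd s * n" using R by (auto simp: admissible_def)
    have "3 * m \<le> 2 * n" if "card F < k" using R num(2) iii that by blast
    moreover have "(3 * int m - int n) * int ((k - card F) * s) \<le> 3 * int (lam * ((n - m) * (m choose 2)))"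
      using R num(3)[OF qk] by blast
    ultimately show ?emb
      by (rule embeds_connected_if[OF assms(1-3,5) sr assms(6-10) qk k dvd])
  qed
qed

end
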